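(* Let $p\ge7$ be a prime. Consider the set of all groups $\langle s,w,A\rangle$, where $A$ ranges over the finite subgroups of $\mathrm{D}(p,\mathbb{C})$ that are invariant under conjugation by $\mathrm{Sym}(p)$ and are not contained in the group of scalar matrices. Each such group is a finite irreducible subgroup of $\mathrm{M}(p,\mathbb{C})$ with permutation part $\mathrm{Alt}(p)$; every finite irreducible subgroup of $\mathrm{M}(p,\mathbb{C})$ with permutation part $\mathrm{Alt}(p)$ is $\mathrm{GL}(p,\mathbb{C})$-conjugate to one of them; and no two distinct ones are $\mathrm{GL}(p,\mathbb{C})$-conjugate.
   Context: $\mathrm{M}(p,\mathbb{C})$ is the group of monomial matrices, $\mathrm{D}(p,\mathbb{C})$ the invertible diagonal matrices; permutations $\alpha$ are identified with permutation matrices $[\delta_{i\alpha,j}]_{i,j}$, and $\mathrm{Alt}(p)$ with the even ones. The permutation part of $G\le\mathrm{M}(p,\mathbb{C})$ is its image under $dt\mapsto t$ ($d$ diagonal, $t$ a permutation matrix). $s$ is the permutation matrix of $(1,2,\ldots,p)$ and $w$ that of $(1,2,3)$. *)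

theory Defs
  imports "Jordan_Normal_Form.Matrix" "HOL-Combinatorics.Permutations" "HOL-Computational_Algebra.Primes"
begin

(* Indices are 0,...,p-1 (the paper's 1,...,p shifted by one). *)

definition perm_mat :: "nat \<Rightarrow> (nat \<Rightarrow> nat) \<Rightarrow> complex mat" where
  "perm_mat p \<alpha> = mat p p (\<lambda>(i,j). if \<alpha> i = j then 1 else 0)"

definition GL :: "nat \<Rightarrow> complex mat set" where
  "GL p = {A. A \<in> carrier_mat p p \<and> invertible_mat A}"

definition Diag :: "nat \<Rightarrow> complex mat set" where
  "Diag p = {d. d \<in> carrier_mat p p \<and> diagonal_mat d \<and> (\<forall>i<p. d $$ (i,i) \<noteq> 0)}"

definition Mon :: "nat \<Rightarrow> complex mat set" where
  "Mon p = {d * perm_mat p \<alpha> | d \<alpha>. d \<in> Diag p \<and> \<alpha> permutes {..<p}}"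

definition Scal :: "nat \<Rightarrow> complex mat set" where
  "Scal p = {c \<cdot>\<^sub>m 1\<^sub>m p | c. c \<noteq> 0}"

definition mat_subgroup :: "nat \<Rightarrow> complex mat set \<Rightarrow> bool" where
  "mat_subgroup p H \<longleftrightarrow> H \<subseteq> carrier_mat p p \<and> 1\<^sub>m p \<in> H \<and>
     (\<forall>a\<in>H. \<forall>b\<in>H. a * b \<in> H) \<and>
     (\<forall>a\<in>H. \<exists>b\<in>H. a * b = 1\<^sub>m p \<and> b * a = 1\<^sub>m p)"

definition gen_group :: "nat \<Rightarrow> complex mat set \<Rightarrow> complex mat set" where
  "gen_group p S = \<Inter>{H. mat_subgroup p H \<and> S \<subseteq> H}"

definition subspace_vec :: "nat \<Rightarrow> complex vec set \<Rightarrow> bool" where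
  "subspace_vec p W \<longleftrightarrow> W \<subseteq> carrier_vec p \<and> 0\<^sub>v p \<in> W \<and>
     (\<forall>u\<in>W. \<forall>v\<in>W. u + v \<in> W) \<and> (\<forall>c. \<forall>v\<in>W. c \<cdot>\<^sub>v v \<in> W)"

definition irreducible_group :: "nat \<Rightarrow> complex mat set \<Rightarrow> bool" where
  "irreducible_group p G \<longleftrightarrow>
     (\<forall>W. subspace_vec p W \<and> (\<forall>g\<in>G. \<forall>v\<in>W. g *\<^sub>v v \<in> W) \<longrightarrow>
          W = {0\<^sub>v p} \<or> W = carrier_vec p)"

definition perm_part :: "nat \<Rightarrow> complex mat set \<Rightarrow> (nat \<Rightarrow> nat) set" where
  "perm_part p G = {\<alpha>. \<alpha> permutes {..<p} \<and> (\<exists>g\<in>G. \<exists>d\<in>Diag p. g = d * perm_mat p \<alpha>)}"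

definition Alt :: "nat \<Rightarrow> (nat \<Rightarrow> nat) set" where
  "Alt p = {\<alpha>. \<alpha> permutes {..<p} \<and> evenperm \<alpha>}"

definition GL_conj :: "nat \<Rightarrow> complex mat set \<Rightarrow> complex mat set \<Rightarrow> bool" where
  "GL_conj p G H \<longleftrightarrow> (\<exists>X\<in>carrier_mat p p. \<exists>Y\<in>carrier_mat p p.
     X * Y = 1\<^sub>m p \<and> Y * X = 1\<^sub>m p \<and> H = {X * g * Y | g. g \<in> G})"

definition s_mat :: "nat \<Rightarrow> complex mat" where
  "s_mat p = perm_mat p (\<lambda>i. if i < p then (i + 1) mod p else i)"

definition w_mat :: "nat \<Rightarrow> complex mat" where
  "w_mat p = perm_mat p (\<lambda>i. if i = 0 then 1 else if i = 1 then 2 else if i = 2 then 0 else i)"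

definition admissible :: "nat \<Rightarrow> complex mat set \<Rightarrow> bool" where
  "admissible p A \<longleftrightarrow> finite A \<and> mat_subgroup p A \<and> A \<subseteq> Diag p \<and>
     (\<forall>\<alpha>. \<alpha> permutes {..<p} \<longrightarrow>
        (\<forall>a\<in>A. perm_mat p \<alpha> * a * perm_mat p (inv_into UNIV \<alpha>) \<in> A)) \<and>
     \<not> A \<subseteq> Scal p"

end

theory Submission
  imports Defs
begin

text \<open>
  Let \<open>A\<close> be a finite diagonal group invariant under the alternating group, and let \<open>U\<close> be the
  group of ratios \<open>a\<^sub>i / a\<^sub>j\<close> of entries of elements of \<open>A\<close>. It is the group of \<open>m\<close>-th roots of
  unity, and \<open>A\<close> contains the group \<open>E\<close> of all diagonal matrices with entries in \<open>U\<close> and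
  determinant 1. In particular \<open>A\<close> is invariant under all permutations.

  Let \<open>G\<close> be a monomial group with permutation part the alternating group and diagonal part \<open>A\<close>.
  Raising all entries to the \<open>m\<close>-th power yields a monomial group whose diagonal part is scalar.
  In such a group a matrix over a 3-cycle is a scalar multiple of a commutator, so its entries at
  fixed points agree. Normalising them to 1, the entry at \<open>(i, j)\<close> depends on \<open>i\<close> and \<open>j\<close> only
  and is a coboundary \<open>e\<^sub>i / e\<^sub>j\<close>. Hence a diagonal conjugate of \<open>G\<close> has, up to scalars, all
  entries in \<open>U\<close>; its commutators are then permutation matrices modulo \<open>E\<close>, and since 3-cycles are
  commutators it contains all even permutation matrices. If \<open>A\<close> were scalar, the constant vectors
  would be invariant.

  In a group of the family, the diagonal part is the largest abelian normal subgroup, so a matrix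
  conjugating one group to another conjugates the diagonal parts. As these have distinct
  coordinate characters, that matrix is monomial, and the diagonal parts are equal by
  permutation invariance.
\<close>

section \<open>Three-cycles and the alternating group\<close>

text \<open>For distinct arguments this is the 3-cycle \<open>(a, b, c)\<close>. The case
  distinction lets identities between cycles be checked pointwise.\<close>

definition tc :: "'a \<Rightarrow> 'a \<Rightarrow> 'a \<Rightarrow> 'a \<Rightarrow> 'a" where
  "tc a b c = (\<lambda>x. if x = a then b else if x = b then c else if x = c then a else x)"

lemma tc_transpose: "distinct [a, b, c] \<Longrightarrow> tc a b c = transpose a b \<circ> transpose b c"
  by (auto simp: tc_def transpose_def fun_eq_iff)

lemma tc_rotate: "distinct [a, b, c] \<Longrightarrow> tc b c a = tc a b c"
  by (auto simp: tc_def fun_eq_iff)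

lemma tc_permutes: "distinct [a, b, c] \<Longrightarrow> {a, b, c} \<subseteq> S \<Longrightarrow> tc a b c permutes S"
  unfolding tc_transpose by (rule permutes_compose; rule permutes_swap_id; simp)

lemma evenperm_tc: "distinct [a, b, c] \<Longrightarrow> evenperm (tc a b c)"
  unfolding tc_transpose by (simp add: evenperm_comp evenperm_swap permutation_swap_id)

lemma tc_inverse: "distinct [a, b, c] \<Longrightarrow> tc c b a \<circ> tc a b c = id"
  by (auto simp: tc_def fun_eq_iff)

lemma inv_tc: "distinct [a, b, c] \<Longrightarrow> inv_into UNIV (tc a b c) = tc c b a"
  using tc_inverse[of a b c] tc_inverse[of c b a] by (intro inv_unique_comp) auto

lemma tc_square: "distinct [a, b, c] \<Longrightarrow> tc a b c \<circ> tc a b c = tc c b a"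
  by (auto simp: tc_def fun_eq_iff)

text \<open>Rearranged, this exhibits \<open>tc a b c\<close> as a commutator of
  \<open>tc a b d\<close> and \<open>tc b e c\<close> without mentioning inverses. The points
  \<open>d\<close> and \<open>e\<close> are auxiliary and are later chosen to avoid prescribed
  points.\<close>

lemma tc_commutator:
  "distinct [a, b, c, d, e] \<Longrightarrow>
    tc a b d \<circ> (tc b e c \<circ> tc a b c) = tc b e c \<circ> tc a b d"
  by (auto simp: tc_def fun_eq_iff)

lemma AltD: "\<alpha> \<in> Alt p \<Longrightarrow> \<alpha> permutes {..<p}" "\<alpha> \<in> Alt p \<Longrightarrow> evenperm \<alpha>"
  by (auto simp: Alt_def)

lemma permutation_Alt: "\<alpha> \<in> Alt p \<Longrightarrow> permutation \<alpha>"
  using permutes_imp_permutation[of "{..<p}" \<alpha>] by (simp add: AltD)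

lemma Alt_comp: "\<alpha> \<in> Alt p \<Longrightarrow> \<beta> \<in> Alt p \<Longrightarrow> \<alpha> \<circ> \<beta> \<in> Alt p"
  using permutation_Alt[of \<alpha> p] permutation_Alt[of \<beta> p]
  by (auto simp: Alt_def evenperm_comp intro: permutes_compose)

lemma Alt_inv: "\<alpha> \<in> Alt p \<Longrightarrow> inv_into UNIV \<alpha> \<in> Alt p"
  using permutation_Alt[of \<alpha> p] by (simp add: Alt_def permutes_inv evenperm_inv)

lemma Alt_id: "id \<in> Alt p"
  by (simp add: Alt_def permutes_id evenperm_id)

lemma Alt_tc: "distinct [a, b, c] \<Longrightarrow> {a, b, c} \<subseteq> {..<p} \<Longrightarrow> tc a b c \<in> Alt p"
  by (simp add: Alt_def tc_permutes evenperm_tc del: insert_subset)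

lemma finite_Alt: "finite (Alt p)"
  by (rule finite_subset[OF _ finite_permutations[of "{..<p}"]]) (auto simp: Alt_def)

lemma Alt_two: "\<alpha> \<in> Alt 2 \<Longrightarrow> \<alpha> = id"
proof -
  assume a: "\<alpha> \<in> Alt 2"
  have s: "{..<2::nat} = {0, 1}" by auto
  have "\<alpha> = id \<or> \<alpha> = transpose 0 1"
    using AltD(1)[OF a] unfolding s by (simp add: permutes_doubleton_iff)
  with AltD(2)[OF a] show ?thesis by (auto simp: evenperm_swap)
qed

text \<open>Induction on \<open>n\<close> gives \<open>Alt n \<subseteq> T\<close>: an even
  permutation of \<open>n + 1\<close> points is composed with 3-cycles until it fixes
  \<open>n\<close>, and then it is an even permutation of \<open>n\<close> points. The inverse
  \<open>\<gamma>'\<close> of the correcting permutation is kept inside \<open>T\<close>.\<close>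

lemma Alt_generated:
  assumes id: "id \<in> T"
    and comp: "\<And>\<alpha> \<beta>. \<alpha> \<in> T \<Longrightarrow> \<beta> \<in> T \<Longrightarrow> \<alpha> \<circ> \<beta> \<in> T"
    and tc: "\<And>k. k + 2 < p \<Longrightarrow> tc k (k+1) (k+2) \<in> T"
    and p: "2 \<le> p"
  shows "Alt p \<subseteq> T"
proof -
  \<comment> \<open>The square of a 3-cycle is its inverse, so \<open>T\<close>, assumed closed
    under composition only, contains the inverses of its generators.\<close>
  have tc': "tc (k+2) (k+1) k \<in> T" if "k + 2 < p" for k
    using comp[OF tc[OF that] tc[OF that]] tc_square[of k "k+1" "k+2"] by simp
  have move: "\<exists>\<gamma> \<gamma>'. \<gamma> \<in> Alt (Suc n) \<and> \<gamma>' \<in> T \<and> \<gamma>' \<circ> \<gamma> = id \<and> \<gamma> j = n"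
    if "j \<le> n" "2 \<le> n" "n < p" for j n
    using that
  proof (induction "n - j" arbitrary: j)
    case 0
    then have "j = n" by simp
    then show ?case using Alt_id id by (metis comp_id id_apply)
  next
    case (Suc d)
    \<comment> \<open>The cycle \<open>tc j (j+1) (j+2)\<close> sends \<open>j\<close> to
      \<open>j + 1\<close>, but for \<open>j + 1 = n\<close> it leaves the range; there the last
      cycle \<open>tc (n-2) (n-1) n\<close> sends \<open>n - 1\<close> to \<open>n\<close>
      instead.\<close>
    define t where "t = (if j + 1 = n then tc (n-2) (n-1) n else tc j (j+1) (j+2))"
    define t' where "t' = (if j + 1 = n then tc n (n-1) (n-2) else tc (j+2) (j+1) j)"
    have "d = n - (j + 1)" "j + 1 \<le> n" using Suc.hyps(2) by auto
    with Suc obtain \<gamma> \<gamma>' where g: "\<gamma> \<in> Alt (Suc n)" "\<gamma>' \<in> T" "\<gamma>' \<circ> \<gamma> = id" "\<gamma> (j+1) = n"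
      by blast
    have t: "t \<in> Alt (Suc n)" using Suc.prems \<open>j + 1 \<le> n\<close>
      unfolding t_def by (auto intro!: Alt_tc)
    have t': "t' \<in> T"
    proof (cases "j + 1 = n")
      case True
      then show ?thesis using Suc.prems tc'[of "n-2"]
        by (simp add: t'_def numeral_2_eq_2 Suc_diff_Suc)
    next
      case False
      then show ?thesis using Suc.prems tc'[of j] \<open>j + 1 \<le> n\<close> by (simp add: t'_def)
    qed
    have tt: "t' \<circ> t = id"
      using Suc.prems unfolding t_def t'_def by (auto intro!: tc_inverse)
    have tj: "t j = j + 1" using Suc.prems by (auto simp: t_def tc_def)
    have "(t' \<circ> \<gamma>') \<circ> (\<gamma> \<circ> t) = id"
      using g(3) tt by (metis comp_assoc comp_id)
    then show ?case using Alt_comp[OF g(1) t] comp[OF t' g(2)] g(4) tj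
      by (intro exI[of _ "\<gamma> \<circ> t"] exI[of _ "t' \<circ> \<gamma>'"]) auto
  qed
  have "2 \<le> n \<Longrightarrow> n \<le> p \<Longrightarrow> Alt n \<subseteq> T" for n
  proof (induction n rule: dec_induct)
    case base
    then show ?case using Alt_two id by auto
  next
    case (step n)
    show ?case
    proof
      fix \<alpha> assume a: "\<alpha> \<in> Alt (Suc n)"
      have "\<alpha> n < Suc n" using permutes_in_image[OF AltD(1)[OF a], of n] by simp
      then obtain \<gamma> \<gamma>' where g: "\<gamma> \<in> Alt (Suc n)" "\<gamma>' \<in> T" "\<gamma>' \<circ> \<gamma> = id" "\<gamma> (\<alpha> n) = n"
        using move[of "\<alpha> n" n] step by auto
      have c: "\<gamma> \<circ> \<alpha> \<in> Alt (Suc n)" using Alt_comp g a by blast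
      have "(\<gamma> \<circ> \<alpha>) permutes {..<n}"
        using AltD(1)[OF c] by (rule permutes_superset) (use g(4) in \<open>auto simp: less_Suc_eq\<close>)
      then have "\<gamma> \<circ> \<alpha> \<in> Alt n" using AltD(2)[OF c] by (simp add: Alt_def)
      then have "\<gamma> \<circ> \<alpha> \<in> T" using step by auto
      then have "\<gamma>' \<circ> (\<gamma> \<circ> \<alpha>) \<in> T" using comp g by blast
      then show "\<alpha> \<in> T" using g(3) by (metis comp_assoc id_comp)
    qed
  qed
  then show ?thesis using p by auto
qed

section \<open>Points outside a short list\<close>

lemma ex_fresh:
  fixes S :: "nat set"
  assumes "card S < p" "finite S"
  shows "\<exists>x<p. x \<notin> S"
proof (rule ccontr)
  assume "\<not> ?thesis"
  then have "{..<p} \<subseteq> S" by auto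
  then show False using card_mono[OF assms(2), of "{..<p}"] assms(1) by simp
qed

lemma ex_fresh_list:
  fixes xs :: "nat list"
  assumes "length xs < p"
  obtains x where "x < p" "x \<notin> set xs"
  using ex_fresh[of "set xs" p] card_length[of xs] assms by auto

section \<open>Monomial cocycles of the alternating group\<close>

text \<open>Abstracts a group of monomial matrices over \<open>Alt p\<close>:
  \<open>M v \<alpha>\<close> says that the matrix with entry \<open>v i\<close> at
  \<open>(i, \<alpha> i)\<close> is a member. The abstraction serves both the group itself and the
  system of entrywise powers. Only values below \<open>p\<close> matter, hence
  \<open>cong\<close>.\<close>

locale mono_system =
  fixes p :: nat and M :: "(nat \<Rightarrow> complex) \<Rightarrow> (nat \<Rightarrow> nat) \<Rightarrow> bool"
  assumes p7: "7 \<le> p"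
    and nonzero: "M v \<alpha> \<Longrightarrow> i < p \<Longrightarrow> v i \<noteq> 0"
    and in_Alt: "M v \<alpha> \<Longrightarrow> \<alpha> \<in> Alt p"
    and surj_Alt: "\<alpha> \<in> Alt p \<Longrightarrow> \<exists>v. M v \<alpha>"
    and mult: "M v \<alpha> \<Longrightarrow> M w \<beta> \<Longrightarrow> M (\<lambda>i. v i * w (\<alpha> i)) (\<beta> \<circ> \<alpha>)"
    and inverse: "M v \<alpha> \<Longrightarrow> M (\<lambda>i. 1 / v (inv_into UNIV \<alpha> i)) (inv_into UNIV \<alpha>)"
    and cong: "M v \<alpha> \<Longrightarrow> (\<And>i. i < p \<Longrightarrow> v i = w i) \<Longrightarrow> M w \<alpha>"
begin

lemma quot:
  assumes "M v \<alpha>" "M w \<beta>"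
  shows "M (\<lambda>i. w i / v (inv_into UNIV \<alpha> (\<beta> i))) (inv_into UNIV \<alpha> \<circ> \<beta>)"
  using mult[OF assms(2) inverse[OF assms(1)]] by simp

lemma quot_same:
  assumes "M v \<alpha>" "M w \<alpha>"
  shows "M (\<lambda>i. w i / v i) id"
  using quot[OF assms] permutes_inv_o(2)[OF AltD(1)[OF in_Alt[OF assms(1)]]]
    permutes_inverses(2)[OF AltD(1)[OF in_Alt[OF assms(1)]]] by simp

text \<open>The two elements multiplied in either order lie over
  \<open>\<beta> \<circ> \<alpha>\<close> and \<open>\<alpha> \<circ> \<beta>\<close>; the
  hypothesis makes \<open>\<kappa>\<close> the quotient of these permutations.\<close>

lemma commutator:
  assumes "M v \<alpha>" "M w \<beta>" "\<alpha> \<circ> (\<beta> \<circ> \<kappa>) = \<beta> \<circ> \<alpha>"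
  shows "M (\<lambda>i. v i * w (\<alpha> i) / (w (\<kappa> i) * v (\<beta> (\<kappa> i)))) \<kappa>"
proof -
  have per: "(\<alpha> \<circ> \<beta>) permutes {..<p}"
    using AltD(1)[OF in_Alt] assms(1,2) permutes_compose by blast
  have k: "inv_into UNIV (\<alpha> \<circ> \<beta>) \<circ> (\<beta> \<circ> \<alpha>) = \<kappa>"
    using permutes_inv_o(2)[OF per] assms(3) by (metis comp_assoc id_comp)
  then have "inv_into UNIV (\<alpha> \<circ> \<beta>) (\<beta> (\<alpha> i)) = \<kappa> i" for i
    by (metis comp_apply)
  with quot[OF mult[OF assms(2,1)] mult[OF assms(1,2)]] k show ?thesis
    by simp
qed

end

text \<open>Elements over one permutation now agree up to a scalar, so the system is a 1-cocycle of
  \<open>Alt p\<close> in the diagonal matrices modulo scalars; \<open>diagonal_conj\<close> shows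
  that it is a coboundary.\<close>

locale scalar_mono_system = mono_system +
  assumes scalar: "M v id \<Longrightarrow> i < p \<Longrightarrow> j < p \<Longrightarrow> v i = v j"
begin

lemma proportional:
  assumes "M v \<alpha>" "M w \<alpha>" "i < p" "j < p"
  shows "w i / v i = w j / v j"
  using scalar[OF quot_same[OF assms(1,2)] assms(3,4)] .

text \<open>A 3-cycle is a commutator of two 3-cycles that fix any two given further points, and
  a commutator of monomial matrices has entry 1 at a common fixed point of the factors.
  This needs seven points.\<close>

lemma fixed_entries_eq:
  assumes x: "M x (tc a b c)" and d: "distinct [a, b, c]" "{a, b, c} \<subseteq> {..<p}"
    and l: "l < p" "l \<notin> {a, b, c}" and l': "l' < p" "l' \<notin> {a, b, c}"
  shows "x l = x l'"
proof -
  obtain e where e: "e < p" "e \<notin> set [a, b, c, l, l']"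
    by (rule ex_fresh_list[of "[a, b, c, l, l']" p]) (use p7 in auto)
  obtain f where f: "f < p" "f \<notin> set [a, b, c, l, l', e]"
    by (rule ex_fresh_list[of "[a, b, c, l, l', e]" p]) (use p7 in auto)
  have "tc a b e \<in> Alt p" "tc b f c \<in> Alt p"
    using d e f by (auto intro!: Alt_tc)
  then obtain v w where v: "M v (tc a b e)" and w: "M w (tc b f c)"
    using surj_Alt by blast
  define y where "y = (\<lambda>i. v i * w (tc a b e i) / (w (tc a b c i) * v (tc b f c (tc a b c i))))"
  have y: "M y (tc a b c)"
    unfolding y_def by (rule commutator[OF v w tc_commutator]) (use d e f in auto)
  have "y l = 1" "y l' = 1"
    using d l l' e f nonzero[OF v] nonzero[OF w] by (auto simp: y_def tc_def)
  with proportional[OF y x l(1) l'(1)] show ?thesis by simp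
qed

text \<open>\<open>r\<close> is the entry at \<open>(i, j)\<close> of an element over a 3-cycle
  sending \<open>i\<close> to \<open>j\<close>, scaled so that the entry at the fixed point
  \<open>l\<close> is 1. It is a relation because independence of \<open>k\<close>, \<open>l\<close>
  and \<open>x\<close> is proved only afterwards.\<close>

definition pair_entry :: "nat \<Rightarrow> nat \<Rightarrow> complex \<Rightarrow> bool" where
  "pair_entry i j r \<longleftrightarrow> (\<exists>k l x. distinct [i, j, k, l] \<and> {i, j, k, l} \<subseteq> {..<p} \<and>
     M x (tc i j k) \<and> r = x i / x l)"

lemma pair_entryI:
  assumes "M x (tc i j k)" "distinct [i, j, k, l]" "{i, j, k, l} \<subseteq> {..<p}"
  shows "pair_entry i j (x i / x l)"
  using assms unfolding pair_entry_def by blast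

lemma pair_entry_ex:
  assumes "i \<noteq> j" "i < p" "j < p"
  shows "\<exists>r. pair_entry i j r"
proof -
  obtain k where k: "k < p" "k \<notin> set [i, j]"
    by (rule ex_fresh_list[of "[i, j]" p]) (use p7 in auto)
  obtain l where l: "l < p" "l \<notin> set [i, j, k]"
    by (rule ex_fresh_list[of "[i, j, k]" p]) (use p7 in auto)
  have "tc i j k \<in> Alt p" using assms k by (auto intro!: Alt_tc)
  then obtain x where "M x (tc i j k)" using surj_Alt by blast
  then show ?thesis using pair_entryI[of x i j k l] assms k l by auto
qed

text \<open>For equal third points the two elements are proportional. For different ones their
  quotient lies over \<open>tc j k' k\<close>, which fixes both \<open>i\<close> and
  \<open>m\<close>, so its entries there agree.\<close>

lemma pair_entry_unique:
  assumes "pair_entry i j r" "pair_entry i j r'"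
  shows "r = r'"
proof -
  obtain k l x where x: "distinct [i, j, k, l]" "{i, j, k, l} \<subseteq> {..<p}"
     "M x (tc i j k)" "r = x i / x l" using assms(1) unfolding pair_entry_def by blast
  obtain k' l' x' where x': "distinct [i, j, k', l']" "{i, j, k', l'} \<subseteq> {..<p}"
     "M x' (tc i j k')" "r' = x' i / x' l'" using assms(2) unfolding pair_entry_def by blast
  \<comment> \<open>\<open>m\<close> is fixed by both cycles, so both entries can be normalised at
    the same point.\<close>
  obtain m where m: "m < p" "m \<notin> set [i, j, k, k']"
    by (rule ex_fresh_list[of "[i, j, k, k']" p]) (use p7 in auto)
  have r: "r = x i / x m"
    using fixed_entries_eq[OF x(3), of l m] x m by auto
  have r': "r' = x' i / x' m"
    using fixed_entries_eq[OF x'(3), of l' m] x' m by auto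
  have nz: "x i \<noteq> 0" "x m \<noteq> 0" "x' i \<noteq> 0" "x' m \<noteq> 0"
    using nonzero[OF x(3)] nonzero[OF x'(3)] x(2) m by auto
  show ?thesis
  proof (cases "k = k'")
    case True
    then have "x' i / x i = x' m / x m"
      using proportional[OF x(3), of x' i m] x'(3) x(2) m by auto
    with nz show ?thesis unfolding r r' by (simp add: field_simps)
  next
    case False
    have eq: "inv_into UNIV (tc i j k) \<circ> tc i j k' = tc j k' k"
      using x(1) x'(1) False by (simp add: inv_tc) (auto simp: tc_def fun_eq_iff)
    define y where "y = (\<lambda>q. x' q / x (tc j k' k q))"
    have "M y (tc j k' k)"
      using quot[OF x(3) x'(3)] unfolding eq
      by (rule cong) (use eq in \<open>simp add: y_def fun_eq_iff\<close>)
    then have "y i = y m"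
      by (rule fixed_entries_eq) (use x x' m False in auto)
    then have "x' i / x i = x' m / x m"
      using x(1) x'(1) m by (simp add: y_def tc_def split: if_splits)
    with nz show ?thesis unfolding r r' by (simp add: field_simps)
  qed
qed

text \<open>A single element over \<open>tc i j k\<close> supplies both factors, and its square lies
  over \<open>tc i k j\<close>, where the entry at \<open>i\<close> is the product of the entries at
  \<open>i\<close> and \<open>j\<close>.\<close>

lemma pair_entry_trans:
  assumes "pair_entry i j r" "pair_entry j k r'" "distinct [i, j, k]" "k < p"
  shows "pair_entry i k (r * r')"
proof -
  have ij: "i < p" "j < p" using assms(1) by (auto simp: pair_entry_def)
  obtain l where l: "l < p" "l \<notin> set [i, j, k]"
    by (rule ex_fresh_list[of "[i, j, k]" p]) (use p7 in auto)
  have "tc i j k \<in> Alt p" using assms ij by (auto intro!: Alt_tc)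
  then obtain x where x: "M x (tc i j k)" using surj_Alt by blast
  have "pair_entry i j (x i / x l)" by (rule pair_entryI[OF x]) (use assms ij l in auto)
  then have r: "r = x i / x l" using pair_entry_unique assms(1) by blast
  have "pair_entry j k (x j / x l)"
    by (rule pair_entryI[of _ _ _ i]) (use x tc_rotate[of i j k] assms ij l in auto)
  then have r': "r' = x j / x l" using pair_entry_unique assms(2) by blast
  have "M (\<lambda>q. x q * x (tc i j k q)) (tc i k j)"
    using mult[OF x x] tc_square[of i j k] tc_rotate[of i k j] assms(3) by simp
  from pair_entryI[OF this, of l] show ?thesis
    using assms ij l by (simp add: r r' tc_def split: if_splits)
qed

text \<open>The inverse of an element over \<open>tc i j k\<close> lies over \<open>tc j i k\<close>
  and has reciprocal entries.\<close>

lemma pair_entry_sym: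
  assumes "pair_entry i j r"
  shows "pair_entry j i (1 / r)"
proof -
  obtain k l x where x: "distinct [i, j, k, l]" "{i, j, k, l} \<subseteq> {..<p}"
     "M x (tc i j k)" "r = x i / x l" using assms(1) unfolding pair_entry_def by blast
  have "M (\<lambda>q. 1 / x (tc k j i q)) (tc j i k)"
    using inverse[OF x(3)] inv_tc[of i j k] tc_rotate[of k j i] x(1) by simp
  from pair_entryI[OF this, of l] show ?thesis
    using x by (simp add: tc_def split: if_splits)
qed

lemma pair_entry_nonzero: "pair_entry i j r \<Longrightarrow> r \<noteq> 0"
  unfolding pair_entry_def using nonzero by (metis divide_eq_0_iff insert_subset lessThan_iff)

text \<open>The potential \<open>e\<close> is read off from the pairs ending at the base point 0;
  transitivity and symmetry reduce every other pair to these.\<close>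

lemma pair_entry_coboundary:
  obtains e where "\<And>i. i < p \<Longrightarrow> e i \<noteq> 0"
    "\<And>i j r. pair_entry i j r \<Longrightarrow> r = e i / e j"
proof -
  \<comment> \<open>\<open>pair_entry\<close> relates distinct points only, so the base point
    receives the value 1 separately.\<close>
  define e where "e i = (if i = 0 then 1 else SOME r. pair_entry i 0 r)" for i
  have e: "pair_entry i 0 (e i)" if "i \<noteq> 0" "i < p" for i
    using someI_ex[OF pair_entry_ex[of i 0]] that p7 by (simp add: e_def)
  have nz: "e i \<noteq> 0" if "i < p" for i
    using pair_entry_nonzero[OF e[of i]] that by (cases "i = 0") (auto simp: e_def)
  have "r = e i / e j" if c: "pair_entry i j r" for i j r
  proof -
    have ij: "i < p" "j < p" "i \<noteq> j" using c by (auto simp: pair_entry_def)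
    consider "i = 0" "j \<noteq> 0" | "i \<noteq> 0" "j = 0" | "i \<noteq> 0" "j \<noteq> 0" using ij by auto
    then show ?thesis
    proof cases
      case 1
      then have "r = 1 / e j" using pair_entry_sym[OF e[of j]] c pair_entry_unique ij by blast
      then show ?thesis using 1 by (simp add: e_def)
    next
      case 2
      then have "r = e i" using e[of i] c pair_entry_unique ij by blast
      then show ?thesis using 2 by (simp add: e_def)
    next
      case 3
      have "pair_entry i 0 (r * e j)"
        by (rule pair_entry_trans[OF c]) (use e[of j] 3 ij p7 in auto)
      then have "e i = r * e j" using pair_entry_unique e 3 ij by blast
      then show ?thesis using nz ij by simp
    qed
  qed
  with nz that show thesis by blast
qed

text \<open>The second property says that conjugation by the diagonal matrix with entries
  \<open>1 / e i\<close> turns every element into a scalar multiple of a permutation matrix.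
  Permutations over which some element has this property are closed under composition and include
  the 3-cycles of consecutive points; other elements over the same permutation are
  proportional.\<close>

lemma diagonal_conj:
  obtains e where "\<And>i. i < p \<Longrightarrow> e i \<noteq> 0"
    "\<And>v \<alpha>. M v \<alpha> \<Longrightarrow> \<exists>z. \<forall>i<p. v i * e (\<alpha> i) = z * e i"
proof -
  obtain e where e: "\<And>i. i < p \<Longrightarrow> e i \<noteq> 0" "\<And>i j r. pair_entry i j r \<Longrightarrow> r = e i / e j"
    using pair_entry_coboundary by blast
  define T where "T = {\<alpha>. \<exists>v z. M v \<alpha> \<and> (\<forall>i<p. v i * e (\<alpha> i) = z * e i)}"
  have lt: "\<alpha> i < p" if "M v \<alpha>" "i < p" for v \<alpha> i
    using permutes_in_image[OF AltD(1)[OF in_Alt[OF that(1)]], of i] that(2) by simp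
  have "Alt p \<subseteq> T"
  proof (rule Alt_generated)
    obtain v where v: "M v id" using surj_Alt[OF Alt_id] by blast
    have "v i = v 0" if "i < p" for i using scalar[OF v that, of 0] p7 by simp
    then have "\<forall>i<p. v i * e (id i) = v 0 * e i" by (metis id_apply)
    with v show "id \<in> T" unfolding T_def by blast
  next
    fix \<alpha> \<beta> assume "\<alpha> \<in> T" "\<beta> \<in> T"
    then obtain v z w y where v: "M v \<alpha>" "\<And>i. i < p \<Longrightarrow> v i * e (\<alpha> i) = z * e i"
      and w: "M w \<beta>" "\<And>i. i < p \<Longrightarrow> w i * e (\<beta> i) = y * e i" unfolding T_def by blast
    have "w i * v (\<beta> i) * e ((\<alpha> \<circ> \<beta>) i) = (y * z) * e i" if "i < p" for i
    proof -
      have "w i * v (\<beta> i) * e ((\<alpha> \<circ> \<beta>) i) = w i * (z * e (\<beta> i))"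
        using v(2)[of "\<beta> i"] lt[OF w(1) that] by simp
      also have "\<dots> = z * (w i * e (\<beta> i))" by simp
      also have "\<dots> = (y * z) * e i" using w(2)[OF that] by simp
      finally show ?thesis .
    qed
    then show "\<alpha> \<circ> \<beta> \<in> T" using mult[OF w(1) v(1)] unfolding T_def by blast
  next
    fix k assume k: "k + 2 < p"
    let ?a = "k" let ?b = "k + 1" let ?c = "k + 2"
    have d: "distinct [?a, ?b, ?c]" by simp
    obtain x where x: "M x (tc ?a ?b ?c)" using surj_Alt[OF Alt_tc[OF d]] k by auto
    obtain l where l: "l < p" "l \<notin> set [?a, ?b, ?c]"
      by (rule ex_fresh_list[of "[?a, ?b, ?c]" p]) (use p7 in auto)
    have nl: "x l \<noteq> 0" using nonzero x l by blast
    have entries: "pair_entry ?a ?b (x ?a / x l)" "pair_entry ?b ?c (x ?b / x l)" "pair_entry ?c ?a (x ?c / x l)"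
      using x pair_entryI[of x ?a ?b ?c l] pair_entryI[of x ?b ?c ?a l] pair_entryI[of x ?c ?a ?b l] k l
        tc_rotate[of ?a ?b ?c] tc_rotate[of ?b ?c ?a] by auto
    have "x i * e (tc ?a ?b ?c i) = x l * e i" if "i < p" for i
    proof (cases "i \<in> {?a, ?b, ?c}")
      case True
      have "x i / x l = e i / e (tc ?a ?b ?c i)"
        using True entries[THEN e(2)] by (auto simp: tc_def)
      moreover have "e (tc ?a ?b ?c i) \<noteq> 0" using e(1) lt[OF x that] by blast
      ultimately show ?thesis using nl by (simp add: field_simps)
    next
      case False
      then have "x i = x l" by (intro fixed_entries_eq[OF x d]) (use k l that in auto)
      then show ?thesis using False by (simp add: tc_def)
    qed
    then show "tc k (k + 1) (k + 2) \<in> T" using x unfolding T_def by blast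
  qed (use p7 in simp)
  have "\<exists>z. \<forall>i<p. v i * e (\<alpha> i) = z * e i" if v: "M v \<alpha>" for v \<alpha>
  proof -
    from \<open>Alt p \<subseteq> T\<close> in_Alt[OF v] obtain w z where
      w: "M w \<alpha>" "\<And>i. i < p \<Longrightarrow> w i * e (\<alpha> i) = z * e i" unfolding T_def by blast
    have "v i * e (\<alpha> i) = (v 0 / w 0 * z) * e i" if "i < p" for i
    proof -
      have "v i = v 0 / w 0 * w i"
        using proportional[OF w(1) v that, of 0] nonzero[OF w(1) that] p7 by (simp add: field_simps)
      then show ?thesis using w(2)[OF that] by simp
    qed
    then show ?thesis by blast
  qed
  with e(1) that show thesis by blast
qed

end

section \<open>Monomial matrices\<close>

text \<open>This is the diagonal matrix of \<open>v\<close> times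
  \<open>perm_mat p \<alpha>\<close>; \<open>\<alpha> = id\<close> gives the diagonal
  matrices.\<close>

definition mono_mat :: "nat \<Rightarrow> (nat \<Rightarrow> complex) \<Rightarrow> (nat \<Rightarrow> nat) \<Rightarrow> complex mat" where
  "mono_mat p v \<alpha> = mat p p (\<lambda>(i,j). if \<alpha> i = j then v i else 0)"

lemma mono_mat_carrier [simp]: "mono_mat p v \<alpha> \<in> carrier_mat p p"
  by (simp add: mono_mat_def)

lemma mono_mat_index: "i < p \<Longrightarrow> j < p \<Longrightarrow> mono_mat p v \<alpha> $$ (i, j) = (if \<alpha> i = j then v i else 0)"
  by (simp add: mono_mat_def)

lemma perm_mat_eq: "perm_mat p \<alpha> = mono_mat p (\<lambda>_. 1) \<alpha>"
  by (simp add: perm_mat_def mono_mat_def)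

lemma one_mat_eq: "1\<^sub>m p = mono_mat p (\<lambda>_. 1) id"
  by (rule eq_matI) (auto simp: mono_mat_def)

lemma mono_mat_cong: "(\<And>i. i < p \<Longrightarrow> v i = w i) \<Longrightarrow> mono_mat p v \<alpha> = mono_mat p w \<alpha>"
  by (rule eq_matI) (auto simp: mono_mat_def)

lemma permutes_less: "\<alpha> permutes {..<p} \<Longrightarrow> i < p \<Longrightarrow> \<alpha> i < (p::nat)"
  using permutes_in_image[of \<alpha> "{..<p}" i] by simp

text \<open>Row \<open>i\<close> of the first factor selects row \<open>\<alpha> i\<close> of the
  second, which is why the permutations compose in reverse order.\<close>

lemma mono_mat_mult:
  assumes "\<alpha> permutes {..<p}"
  shows "mono_mat p v \<alpha> * mono_mat p w \<beta> = mono_mat p (\<lambda>i. v i * w (\<alpha> i)) (\<beta> \<circ> \<alpha>)"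
proof (rule eq_matI)
  fix i j assume "i < dim_row (mono_mat p (\<lambda>i. v i * w (\<alpha> i)) (\<beta> \<circ> \<alpha>))"
    "j < dim_col (mono_mat p (\<lambda>i. v i * w (\<alpha> i)) (\<beta> \<circ> \<alpha>))"
  then have ij: "i < p" "j < p" by (auto simp: mono_mat_def)
  have "(mono_mat p v \<alpha> * mono_mat p w \<beta>) $$ (i, j) =
      (\<Sum>k\<in>{0..<p}. mono_mat p v \<alpha> $$ (i, k) * mono_mat p w \<beta> $$ (k, j))"
    using ij by (simp add: mono_mat_def scalar_prod_def)
  also have "\<dots> = (\<Sum>k\<in>{0..<p}. if \<alpha> i = k then v i * (if \<beta> k = j then w k else 0) else 0)"
    using ij by (intro sum.cong) (auto simp: mono_mat_index)
  also have "\<dots> = v i * (if \<beta> (\<alpha> i) = j then w (\<alpha> i) else 0)"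
    using permutes_less[OF assms ij(1)] by (simp add: sum.delta)
  finally show "(mono_mat p v \<alpha> * mono_mat p w \<beta>) $$ (i, j) =
      mono_mat p (\<lambda>i. v i * w (\<alpha> i)) (\<beta> \<circ> \<alpha>) $$ (i, j)"
    using ij by (simp add: mono_mat_index)
qed (simp_all add: mono_mat_def)

lemma mono_mat_eqD:
  assumes "mono_mat p v \<alpha> = mono_mat p w \<beta>" "\<alpha> permutes {..<p}" "\<beta> permutes {..<p}"
    "\<And>i. i < p \<Longrightarrow> w i \<noteq> 0"
  shows "\<alpha> = \<beta>" "i < p \<Longrightarrow> v i = w i"
proof -
  have e: "\<alpha> i = \<beta> i \<and> v i = w i" if "i < p" for i
  proof -
    have "mono_mat p v \<alpha> $$ (i, \<beta> i) = mono_mat p w \<beta> $$ (i, \<beta> i)" using assms(1) by simp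
    then show ?thesis
      using that permutes_less[OF assms(3) that] assms(4)[OF that]
      by (auto simp: mono_mat_index split: if_splits)
  qed
  show "\<alpha> = \<beta>"
  proof
    fix i show "\<alpha> i = \<beta> i"
      using e[of i] assms(2,3) by (cases "i < p") (auto simp: permutes_def)
  qed
  show "i < p \<Longrightarrow> v i = w i" using e by blast
qed

lemma mono_mat_in_Diag: "mono_mat p v id \<in> Diag p \<longleftrightarrow> (\<forall>i<p. v i \<noteq> 0)"
  by (auto simp: Diag_def diagonal_mat_def mono_mat_def)

lemma DiagE:
  assumes "d \<in> Diag p"
  obtains v where "d = mono_mat p v id" "\<And>i. i < p \<Longrightarrow> v i \<noteq> 0"
proof
  show "d = mono_mat p (\<lambda>i. d $$ (i, i)) id"
    using assms by (intro eq_matI) (auto simp: Diag_def diagonal_mat_def mono_mat_def)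
  show "\<And>i. i < p \<Longrightarrow> d $$ (i, i) \<noteq> 0"
    using assms by (simp add: Diag_def)
qed

lemma diag_mult_perm_mat: "mono_mat p v id * perm_mat p \<alpha> = mono_mat p v \<alpha>"
  by (simp add: perm_mat_eq mono_mat_mult permutes_id)

lemma MonE:
  assumes "g \<in> Mon p"
  obtains v \<alpha> where "g = mono_mat p v \<alpha>" "\<alpha> permutes {..<p}" "\<And>i. i < p \<Longrightarrow> v i \<noteq> 0"
proof -
  from assms obtain d \<alpha> where g: "g = d * perm_mat p \<alpha>" "d \<in> Diag p" "\<alpha> permutes {..<p}"
    unfolding Mon_def by blast
  obtain v where "d = mono_mat p v id" "\<And>i. i < p \<Longrightarrow> v i \<noteq> 0" using DiagE[OF g(2)] by blast
  with g that show thesis by (simp add: diag_mult_perm_mat)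
qed

lemma mono_mat_in_Mon:
  assumes "\<alpha> permutes {..<p}" "\<And>i. i < p \<Longrightarrow> v i \<noteq> 0"
  shows "mono_mat p v \<alpha> \<in> Mon p"
proof -
  have "mono_mat p v id \<in> Diag p" using assms(2) by (simp add: mono_mat_in_Diag)
  then show ?thesis unfolding Mon_def using assms(1) diag_mult_perm_mat[of p v \<alpha>, symmetric] by blast
qed

lemma mono_mat_in_MonD:
  assumes "mono_mat p v \<alpha> \<in> Mon p" "\<alpha> permutes {..<p}" "i < p"
  shows "v i \<noteq> 0"
proof -
  obtain w \<beta> where w: "mono_mat p v \<alpha> = mono_mat p w \<beta>" "\<beta> permutes {..<p}" "\<And>i. i < p \<Longrightarrow> w i \<noteq> 0"
    using MonE[OF assms(1)] by metis
  show ?thesis using mono_mat_eqD(2)[OF w(1) assms(2) w(2,3) assms(3)] w(3)[OF assms(3)] by simp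
qed

lemma mono_mat_in_DiagD:
  assumes "mono_mat p v \<alpha> \<in> Diag p" "\<alpha> permutes {..<p}"
  shows "\<alpha> = id"
  using DiagE[OF assms(1)] mono_mat_eqD(1)[OF _ assms(2) permutes_id] by metis

lemma perm_part_iff:
  "\<alpha> \<in> perm_part p G \<longleftrightarrow>
     \<alpha> permutes {..<p} \<and> (\<exists>v. (\<forall>i<p. v i \<noteq> 0) \<and> mono_mat p v \<alpha> \<in> G)"
proof
  assume "\<alpha> \<in> perm_part p G"
  then obtain g d where g: "\<alpha> permutes {..<p}" "g \<in> G" "d \<in> Diag p" "g = d * perm_mat p \<alpha>"
    unfolding perm_part_def by blast
  obtain v where v: "d = mono_mat p v id" "\<And>i. i < p \<Longrightarrow> v i \<noteq> 0" using DiagE[OF g(3)] by blast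
  with g show "\<alpha> permutes {..<p} \<and> (\<exists>v. (\<forall>i<p. v i \<noteq> 0) \<and> mono_mat p v \<alpha> \<in> G)"
    by (metis diag_mult_perm_mat)
next
  assume "\<alpha> permutes {..<p} \<and> (\<exists>v. (\<forall>i<p. v i \<noteq> 0) \<and> mono_mat p v \<alpha> \<in> G)"
  then obtain v where v: "\<alpha> permutes {..<p}" "mono_mat p v \<alpha> \<in> G" "mono_mat p v id \<in> Diag p"
    unfolding mono_mat_in_Diag by blast
  then show "\<alpha> \<in> perm_part p G"
    unfolding perm_part_def using diag_mult_perm_mat[of p v \<alpha>, symmetric] by blast
qed

lemma mono_mat_inverse:
  assumes "\<alpha> permutes {..<p}" "\<And>i. i < p \<Longrightarrow> v i \<noteq> 0"
  shows "mono_mat p (\<lambda>i. 1 / v (inv_into UNIV \<alpha> i)) (inv_into UNIV \<alpha>) * mono_mat p v \<alpha> = 1\<^sub>m p"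
proof -
  have i: "inv_into UNIV \<alpha> permutes {..<p}" using assms(1) by (rule permutes_inv)
  show ?thesis
    unfolding mono_mat_mult[OF i] one_mat_eq permutes_inv_o(1)[OF assms(1)]
    using assms(2) permutes_less[OF i] by (intro mono_mat_cong) simp
qed

lemma mat_subgroupD:
  assumes "mat_subgroup p H"
  shows "H \<subseteq> carrier_mat p p" "1\<^sub>m p \<in> H" "a \<in> H \<Longrightarrow> b \<in> H \<Longrightarrow> a * b \<in> H"
  using assms by (auto simp: mat_subgroup_def)

lemma mat_subgroup_left_inverse:
  assumes H: "mat_subgroup p H" and "a \<in> H" "c \<in> carrier_mat p p" "c * a = 1\<^sub>m p"
  shows "c \<in> H"
proof -
  obtain b where b: "b \<in> H" "a * b = 1\<^sub>m p" using H assms(2) by (auto simp: mat_subgroup_def)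
  have "a \<in> carrier_mat p p" "b \<in> carrier_mat p p" using H assms(2) b(1) by (auto simp: mat_subgroup_def)
  then have "c = (c * a) * b" using b(2) assms(3) by (simp add: assoc_mult_mat[of c p p a p b p])
  also have "\<dots> = b" using assms(4) \<open>b \<in> carrier_mat p p\<close> by simp
  finally show ?thesis using b by simp
qed

lemma mono_mat_inverse_in:
  assumes "mat_subgroup p H" "mono_mat p v \<alpha> \<in> H" "\<alpha> permutes {..<p}" "\<And>i. i < p \<Longrightarrow> v i \<noteq> 0"
  shows "mono_mat p (\<lambda>i. 1 / v (inv_into UNIV \<alpha> i)) (inv_into UNIV \<alpha>) \<in> H"
  by (rule mat_subgroup_left_inverse[OF assms(1,2) mono_mat_carrier mono_mat_inverse[OF assms(3,4)]])

text \<open>Multiplication by \<open>u\<close> permutes \<open>U\<close>, so comparing the products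
  over \<open>U\<close> gives \<open>u ^ card U = 1\<close>. There are exactly \<open>card U\<close>
  such roots of unity, so the inclusion is an equality.\<close>

lemma finite_subgroup_complex_roots:
  fixes U :: "complex set"
  assumes fin: "finite U" and one: "1 \<in> U" and mult: "\<And>u v. u \<in> U \<Longrightarrow> v \<in> U \<Longrightarrow> u * v \<in> U"
    and zero: "0 \<notin> U"
  shows "U = {z. z ^ card U = 1}"
proof -
  have pos: "card U > 0" using fin one card_gt_0_iff by blast
  have "u ^ card U = 1" if u: "u \<in> U" for u
  proof -
    have u0: "u \<noteq> 0" using zero u by blast
    have inj: "inj_on ((*) u) U" using u0 by (auto intro: inj_onI)
    have "(*) u ` U = U"
      using mult[OF u] by (intro card_subset_eq[OF fin]) (auto simp: card_image[OF inj])
    then have "prod id U = prod id ((*) u ` U)" by simp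
    also have "\<dots> = (\<Prod>x\<in>U. u * x)" by (simp add: prod.reindex[OF inj])
    also have "\<dots> = u ^ card U * prod id U" by (simp add: prod.distrib)
    finally have "prod id U = u ^ card U * prod id U" .
    moreover have "prod id U \<noteq> 0" using fin zero by (auto simp: prod_zero_iff)
    ultimately show ?thesis by simp
  qed
  then have "U \<subseteq> {z. z ^ card U = 1}" by blast
  from card_subset_eq[OF _ this] show ?thesis
    using card_roots_unity_eq[OF pos] finite_roots_unity[of "card U"] pos by (simp add: Suc_le_eq)
qed

section \<open>Invariant diagonal groups\<close>

text \<open>For \<open>i \<noteq> j\<close> and \<open>u\<close> nonzero, the simplest diagonal
  matrices of determinant 1; with \<open>u\<close> in a group they generate all those of determinant
  1 with entries in that group.\<close>

definition pair_diag :: "nat \<Rightarrow> nat \<Rightarrow> complex \<Rightarrow> nat \<Rightarrow> complex" where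
  "pair_diag i j u = (\<lambda>k. if k = i then u else if k = j then 1 / u else 1)"

text \<open>Invariance is required for 3-cycles only, since in a group over \<open>Alt p\<close>
  just the even permutations are available at first. Invariance under all permutations is derived in
  \<open>permutes_invariant\<close>.\<close>

locale diag_group =
  fixes p :: nat and A :: "complex mat set"
  assumes p7: "7 \<le> p"
    and fin: "finite A"
    and subgroup: "mat_subgroup p A"
    and diag: "A \<subseteq> Diag p"
    and tc_invariant: "distinct [a, b, c] \<Longrightarrow> {a, b, c} \<subseteq> {..<p} \<Longrightarrow>
      mono_mat p v id \<in> A \<Longrightarrow> mono_mat p (v \<circ> tc a b c) id \<in> A"
begin

abbreviation P :: "(nat \<Rightarrow> complex) \<Rightarrow> bool" where "P v \<equiv> mono_mat p v id \<in> A"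

lemma P_nonzero: "P v \<Longrightarrow> i < p \<Longrightarrow> v i \<noteq> 0"
  using diag mono_mat_in_Diag by blast

lemma P_cong: "P v \<Longrightarrow> (\<And>i. i < p \<Longrightarrow> v i = w i) \<Longrightarrow> P w"
  using mono_mat_cong[of p v w id] by simp

lemma P_one: "P (\<lambda>_. 1)"
  using mat_subgroupD(2)[OF subgroup] by (simp add: one_mat_eq)

lemma P_mult: "P v \<Longrightarrow> P w \<Longrightarrow> P (\<lambda>i. v i * w i)"
  using mat_subgroupD(3)[OF subgroup] mono_mat_mult[OF permutes_id, of p v w id] by fastforce

lemma P_inverse: "P v \<Longrightarrow> P (\<lambda>i. 1 / v i)"
  using mono_mat_inverse_in[OF subgroup _ permutes_id, of v] P_nonzero by simp

lemma P_divide: "P v \<Longrightarrow> P w \<Longrightarrow> P (\<lambda>i. v i / w i)"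
  using P_mult[OF _ P_inverse] by simp

text \<open>A 3-cycle through \<open>k\<close>, \<open>i\<close> and a point \<open>x\<close> off
  the support carries the entry \<open>u\<close> from \<open>i\<close> to \<open>k\<close> and
  disturbs nothing else.\<close>

lemma pair_move:
  assumes "P (pair_diag i j u)" "i \<noteq> j" "k \<noteq> j" "i < p" "j < p" "k < p"
  shows "P (pair_diag k j u)"
proof (cases "k = i")
  case False
  obtain x where x: "x < p" "x \<notin> set [i, j, k]"
    by (rule ex_fresh_list[of "[i, j, k]" p]) (use p7 in auto)
  have "P (pair_diag i j u \<circ> tc k i x)"
    by (rule tc_invariant) (use assms x False in auto)
  moreover have "pair_diag i j u \<circ> tc k i x = pair_diag k j u"
    using assms x False by (auto simp: pair_diag_def tc_def fun_eq_iff)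
  ultimately show ?thesis by simp
qed (use assms in simp)

lemma pair_swap: "i \<noteq> j \<Longrightarrow> pair_diag i j u = pair_diag j i (1 / u)"
  by (auto simp: pair_diag_def fun_eq_iff)

lemma pair_move2:
  assumes "P (pair_diag i j u)" "i \<noteq> j" "i \<noteq> k" "i < p" "j < p" "k < p"
  shows "P (pair_diag i k u)"
  using pair_move[of j i "1 / u" k] assms pair_swap[of i j u] pair_swap[of i k u] by auto

lemma pair_all:
  assumes "P (pair_diag i j u)" "i \<noteq> j" "i < p" "j < p" "i' \<noteq> j'" "i' < p" "j' < p"
  shows "P (pair_diag i' j' u)"
proof -
  \<comment> \<open>Passing through a fresh \<open>t\<close> keeps the two places distinct at each
    of the three moves.\<close>
  obtain t where t: "t < p" "t \<notin> set [i, j, i', j']"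
    by (rule ex_fresh_list[of "[i, j, i', j']" p]) (use p7 in auto)
  have "P (pair_diag t j u)" by (rule pair_move[OF assms(1)]) (use assms t in auto)
  then have "P (pair_diag t j' u)" by (rule pair_move2) (use assms t in auto)
  then show ?thesis by (rule pair_move) (use assms t in auto)
qed

text \<open>Membership of pairs makes the group laws immediate. These are exactly the ratios of
  entries: \<open>u\<close> is the ratio of the entries of \<open>pair_diag i j u\<close> at
  \<open>i\<close> and at a third point, and \<open>ratio_U\<close> is the converse.\<close>

definition U :: "complex set" where
  "U = {u. \<forall>i<p. \<forall>j<p. i \<noteq> j \<longrightarrow> P (pair_diag i j u)}"

lemma U_D: "u \<in> U \<Longrightarrow> i < p \<Longrightarrow> j < p \<Longrightarrow> i \<noteq> j \<Longrightarrow> P (pair_diag i j u)"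
  by (simp add: U_def)

lemma U_I: "P (pair_diag i j u) \<Longrightarrow> i \<noteq> j \<Longrightarrow> i < p \<Longrightarrow> j < p \<Longrightarrow> u \<in> U"
  unfolding U_def using pair_all by blast

lemma U_one: "1 \<in> U"
  by (rule U_I[of 0 1]) (use P_one p7 in \<open>auto simp: pair_diag_def if_distrib cong: if_cong\<close>)

lemma U_mult: assumes "u \<in> U" "v \<in> U" shows "u * v \<in> U"
proof (rule U_I[of 0 1])
  have "P (\<lambda>i. pair_diag 0 1 u i * pair_diag 0 1 v i)"
    using P_mult U_D assms p7 by simp
  then show "P (pair_diag 0 1 (u * v))"
    by (rule P_cong) (simp add: pair_diag_def)
qed (use p7 in auto)

lemma U_zero: "0 \<notin> U"
proof
  assume "0 \<in> U"
  then have "P (pair_diag 0 1 0)" using U_D[of 0 0 1] p7 by simp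
  from P_nonzero[OF this, of 0] show False using p7 by (simp add: pair_diag_def)
qed

lemma U_finite: "finite U"
proof -
  have "inj_on (\<lambda>u. mono_mat p (pair_diag 0 1 u) id) U"
  proof (rule inj_onI)
    fix u v
    assume "mono_mat p (pair_diag 0 1 u) id = mono_mat p (pair_diag 0 1 v) id"
    then have "mono_mat p (pair_diag 0 1 u) id $$ (0, 0) = mono_mat p (pair_diag 0 1 v) id $$ (0, 0)"
      by simp
    then show "u = v" using p7 by (simp add: mono_mat_index pair_diag_def)
  qed
  moreover have "(\<lambda>u. mono_mat p (pair_diag 0 1 u) id) ` U \<subseteq> A"
    using U_D p7 by auto
  ultimately show ?thesis using fin inj_on_finite by blast
qed

lemma U_roots: "U = {z. z ^ card U = 1}"
  by (rule finite_subgroup_complex_roots[OF U_finite U_one U_mult U_zero])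

lemma card_U: "card U > 0"
  using U_finite U_one card_gt_0_iff by blast

text \<open>With \<open>b = (a \<circ> (j i k)) / a\<close>, supported on three indices, the quotient of \<open>b\<close> by a
  translate under a 3-cycle meeting the support only in \<open>j\<close> has just two entries different from 1.\<close>

lemma ratio_U:
  assumes a: "P a" and ij: "i < p" "j < p"
  shows "a i / a j \<in> U"
proof (cases "i = j")
  case True
  then show ?thesis using U_one P_nonzero[OF a ij(1)] by simp
next
  case False
  obtain k where k: "k < p" "k \<notin> set [i, j]"
    by (rule ex_fresh_list[of "[i, j]" p]) (use p7 in auto)
  obtain l where l: "l < p" "l \<notin> set [i, j, k]"
    by (rule ex_fresh_list[of "[i, j, k]" p]) (use p7 in auto)
  obtain q where q: "q < p" "q \<notin> set [i, j, k, l]"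
    by (rule ex_fresh_list[of "[i, j, k, l]" p]) (use p7 in auto)
  define b where "b = (\<lambda>x. (a \<circ> tc j i k) x / a x)"
  have b: "P b" unfolding b_def
    by (rule P_divide[OF tc_invariant a]) (use a ij k False in auto)
  define c where "c = (\<lambda>x. b x / (b \<circ> tc j l q) x)"
  have c: "P c" unfolding c_def
    by (rule P_divide[OF b tc_invariant]) (use b ij l q False in auto)
  have nz: "a x \<noteq> 0" if "x < p" for x using P_nonzero[OF a that] .
  have "P (pair_diag j q (a i / a j))"
  proof (rule P_cong[OF c])
    fix x assume "x < p"
    then show "c x = pair_diag j q (a i / a j) x"
      using ij k l q False nz by (auto simp: c_def b_def pair_diag_def tc_def)
  qed
  then show ?thesis by (rule U_I) (use ij q in auto)
qed

lemma ratio_power: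
  assumes "P a" "i < p" "j < p"
  shows "a i ^ card U = a j ^ card U"
proof -
  have "(a i / a j) ^ card U = 1" using ratio_U[OF assms] U_roots by blast
  then show ?thesis using P_nonzero[OF assms(1,3)] by (simp add: power_divide)
qed

text \<open>Multiplying the pairs with \<open>y n\<close> at \<open>n\<close> and its inverse at 0,
  for \<open>1 \<le> n < p\<close>, gives the right entries away from 0; \<open>z n\<close> is the
  partial product. The product condition makes the collected inverses equal to
  \<open>y 0\<close>.\<close>

lemma P_prod_one:
  assumes U: "\<And>i. i < p \<Longrightarrow> y i \<in> U" and prod: "(\<Prod>i<p. y i) = 1"
  shows "P y"
proof -
  define z where "z n = (\<lambda>i. if i = 0 then \<Prod>k\<in>{1..<n}. 1 / y k else if i < n then y i else 1)"
    for n :: nat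
  have z: "P (z n)" if "1 \<le> n" "n \<le> p" for n
    using that
  proof (induction n rule: dec_induct)
    case base
    have "z 1 = (\<lambda>_. 1)" by (auto simp: z_def)
    then show ?case using P_one by (simp only:)
  next
    case (step n)
    have "n < p" using step.prems by simp
    then have "P (pair_diag n 0 (y n))"
      using step.hyps p7 by (intro U_D[OF U]) auto
    then have "P (\<lambda>i. z n i * pair_diag n 0 (y n) i)"
      using step.IH step.prems by (intro P_mult) linarith+
    then show ?case
      by (rule P_cong) (use step in \<open>auto simp: z_def pair_diag_def\<close>)
  qed
  have "(\<Prod>i<p. y i) = y 0 * (\<Prod>k\<in>{1..<p}. y k)"
    using p7 by (simp add: lessThan_atLeast0 prod.atLeast_Suc_lessThan)
  with prod have "(\<Prod>k\<in>{1..<p}. 1 / y k) = y 0"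
    by (simp add: prod_dividef eq_divide_eq) (metis mult_zero_right nonzero_eq_divide_eq zero_neq_one)
  then have "P (z p) \<longleftrightarrow> P y"
    by (intro arg_cong[where f = "\<lambda>x. x \<in> A"] mono_mat_cong) (auto simp: z_def)
  then show ?thesis using z[of p] p7 by simp
qed

text \<open>The quotient of \<open>a \<circ> \<alpha>\<close> by \<open>a\<close> has entries in
  \<open>U\<close> and product 1, because permuting the entries preserves their product. The
  argument covers odd permutations as well.\<close>

lemma permutes_invariant:
  assumes a: "P a" and \<alpha>: "\<alpha> permutes {..<p}"
  shows "P (a \<circ> \<alpha>)"
proof -
  have lt: "\<alpha> i < p" if "i < p" for i using permutes_less[OF \<alpha> that] .
  have "P (\<lambda>i. a (\<alpha> i) / a i)"
  proof (rule P_prod_one)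
    show "a (\<alpha> i) / a i \<in> U" if "i < p" for i using ratio_U[OF a lt[OF that] that] .
    have "(\<Prod>i<p. a (\<alpha> i)) = (\<Prod>i<p. a i)"
      using prod.permute[OF \<alpha>, of a] by (simp add: o_def)
    then show "(\<Prod>i<p. a (\<alpha> i) / a i) = 1"
      using P_nonzero[OF a] by (simp add: prod_dividef)
  qed
  from P_mult[OF a this] show ?thesis
    by (rule P_cong) (use P_nonzero[OF a] in simp)
qed

lemma in_A_E:
  assumes "a \<in> A" obtains v where "a = mono_mat p v id" "P v"
  using DiagE[of a p] diag assms by (metis subsetD)

lemma perm_conj_in:
  assumes "a \<in> A" "\<alpha> permutes {..<p}"
  shows "perm_mat p \<alpha> * a * perm_mat p (inv_into UNIV \<alpha>) \<in> A"
proof -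
  obtain v where v: "a = mono_mat p v id" "P v" using in_A_E[OF assms(1)] .
  show ?thesis using permutes_invariant[OF v(2) assms(2), unfolded comp_def] assms(2)
    by (simp add: v(1) perm_mat_eq mono_mat_mult permutes_inv_o)
qed

lemma scalar_mono_mat: "(\<And>i. i < p \<Longrightarrow> v i = c) \<Longrightarrow> mono_mat p v id = c \<cdot>\<^sub>m 1\<^sub>m p"
  by (rule eq_matI) (auto simp: mono_mat_def)

lemma U_nontrivial:
  assumes "\<not> A \<subseteq> Scal p"
  obtains u where "u \<in> U" "u \<noteq> 1"
proof -
  obtain a where "a \<in> A" "a \<notin> Scal p" using assms by blast
  then obtain v where v: "mono_mat p v id \<notin> Scal p" "P v" using in_A_E by metis
  have "\<exists>i<p. v i \<noteq> v 0"
  proof (rule ccontr)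
    assume "\<not> ?thesis"
    then have "mono_mat p v id = v 0 \<cdot>\<^sub>m 1\<^sub>m p" by (intro scalar_mono_mat) blast
    moreover have "v 0 \<noteq> 0" using P_nonzero[OF v(2)] p7 by simp
    ultimately show False using v(1) unfolding Scal_def by blast
  qed
  then obtain i where "i < p" "v i \<noteq> v 0" by blast
  moreover have "v 0 \<noteq> 0" using P_nonzero[OF v(2)] p7 by simp
  ultimately have "v i / v 0 \<in> U" "v i / v 0 \<noteq> 1"
    using ratio_U[OF v(2), of i 0] p7 by simp_all
  then show thesis using that by blast
qed

end

section \<open>Split extensions by the alternating group\<close>

lemma conj_tc:
  assumes "bij \<alpha>"
  shows "\<alpha> \<circ> tc a b c \<circ> inv_into UNIV \<alpha> = tc (\<alpha> a) (\<alpha> b) (\<alpha> c)"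
proof
  fix x
  obtain y where y: "x = \<alpha> y" using assms by (metis bij_pointE)
  have "inv_into UNIV \<alpha> x = y" using y assms by (simp add: bij_is_inj)
  then show "(\<alpha> \<circ> tc a b c \<circ> inv_into UNIV \<alpha>) x = tc (\<alpha> a) (\<alpha> b) (\<alpha> c) x"
    using y assms by (auto simp: tc_def bij_is_inj inj_eq)
qed

section \<open>The p-cycle and the generation of even permutations\<close>

definition shift :: "nat \<Rightarrow> nat \<Rightarrow> nat" where
  "shift p = (\<lambda>i. if i < p then (i + 1) mod p else i)"

lemma s_mat_eq: "s_mat p = perm_mat p (shift p)"
  by (simp add: s_mat_def shift_def)

lemma w_mat_eq: "w_mat p = perm_mat p (tc 0 1 2)"
  unfolding w_mat_def by (rule arg_cong[where f = "perm_mat p"]) (auto simp: tc_def fun_eq_iff)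

lemma shift_funpow: "i < p \<Longrightarrow> (shift p ^^ n) i = (i + n) mod p"
  by (induction n) (auto simp: shift_def mod_Suc_eq)

lemma shift_funpow_id: "shift p ^^ p = id"
proof
  fix i
  have "(shift p ^^ n) i = i" if "\<not> i < p" for n
    using that by (induction n) (auto simp: shift_def)
  then show "(shift p ^^ p) i = id i"
    by (cases "i < p") (auto simp: shift_funpow)
qed

lemma shift_permutes:
  assumes "0 < p"
  shows "shift p permutes {..<p}"
proof (rule bij_imp_permutes)
  obtain n where n: "p = Suc n" using assms by (cases p) auto
  have "inj (shift p)"
  proof (rule inj_on_inverseI)
    \<comment> \<open>As the \<open>p\<close>-th power is the identity, the power with exponent
      \<open>n = p - 1\<close> is a left inverse.\<close>
    show "(shift p ^^ n) (shift p x) = x" for x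
      using fun_cong[OF shift_funpow_id[of p], of x] unfolding n funpow_Suc_right by simp
  qed
  then have "inj_on (shift p) {..<p}" by (rule inj_on_subset) simp
  moreover have "shift p ` {..<p} \<subseteq> {..<p}" by (auto simp: shift_def)
  ultimately show "bij_betw (shift p) {..<p} {..<p}"
    using endo_inj_surj[of "{..<p}" "shift p"] by (simp add: bij_betw_def)
qed (auto simp: shift_def)

text \<open>If the cycle were odd, so would be its \<open>p\<close>-th power for odd
  \<open>p\<close>, but that power is the identity.\<close>

lemma shift_Alt:
  assumes "odd p"
  shows "shift p \<in> Alt p"
proof -
  have perm: "shift p permutes {..<p}" using shift_permutes odd_pos[OF assms] by blast
  then have pm: "permutation (shift p)" by (rule permutes_imp_permutation[rotated]) simp
  have "evenperm (shift p)"
  proof (rule ccontr)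
    assume ne: "\<not> ?thesis"
    have "permutation (shift p ^^ n) \<and> evenperm (shift p ^^ n) = even n" for n
    proof (induction n)
      case 0
      then show ?case by (simp add: evenperm_id permutation_id)
    next
      case (Suc n)
      have "shift p ^^ Suc n = shift p \<circ> shift p ^^ n" by simp
      then show ?case
        using Suc pm ne permutation_compose[OF pm] evenperm_comp[OF pm] by (metis even_Suc)
    qed
    then show False using assms shift_funpow_id[of p] evenperm_id by metis
  qed
  with perm show ?thesis by (simp add: Alt_def)
qed

lemma perm_mat_mult: "\<alpha> permutes {..<p} \<Longrightarrow> perm_mat p \<alpha> * perm_mat p \<beta> = perm_mat p (\<beta> \<circ> \<alpha>)"
  by (simp add: perm_mat_eq mono_mat_mult)

lemma perm_mat_inverse_in:
  "mat_subgroup p H \<Longrightarrow> perm_mat p \<alpha> \<in> H \<Longrightarrow> \<alpha> permutes {..<p} \<Longrightarrow>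
    perm_mat p (inv_into UNIV \<alpha>) \<in> H"
  using mono_mat_inverse_in[of p H "\<lambda>_. 1" \<alpha>] by (simp add: perm_mat_eq)

text \<open>Conjugating \<open>tc 0 1 2\<close> repeatedly by the shift yields every 3-cycle of
  consecutive points; below \<open>p\<close> no wrap-around occurs.\<close>

lemma Alt_subset_of_generators:
  assumes H: "mat_subgroup p H" and s: "s_mat p \<in> H" and w: "w_mat p \<in> H" and p: "2 < p"
    and \<alpha>: "\<alpha> \<in> Alt p"
  shows "perm_mat p \<alpha> \<in> H"
proof -
  define T where "T = {\<alpha>. \<alpha> permutes {..<p} \<and> perm_mat p \<alpha> \<in> H}"
  have s_perm: "shift p permutes {..<p}" using p by (intro shift_permutes) simp
  have T_comp: "\<alpha> \<circ> \<beta> \<in> T" if "\<alpha> \<in> T" "\<beta> \<in> T" for \<alpha> \<beta>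
    using that mat_subgroupD(3)[OF H, of "perm_mat p \<beta>" "perm_mat p \<alpha>"]
    by (auto simp: T_def perm_mat_mult permutes_compose)
  have T_s: "shift p \<in> T" "inv_into UNIV (shift p) \<in> T"
    using s s_perm perm_mat_inverse_in[OF H] by (auto simp: T_def s_mat_eq permutes_inv)
  have T_tc: "tc k (k + 1) (k + 2) \<in> T" if "k + 2 < p" for k
    using that
  proof (induction k)
    case 0
    then show ?case using w tc_permutes[of 0 1 2 "{..<p}"] by (simp add: T_def w_mat_eq numeral_2_eq_2)
  next
    case (Suc k)
    then have "shift p \<circ> tc k (k + 1) (k + 2) \<circ> inv_into UNIV (shift p) \<in> T"
      by (intro T_comp T_s) simp
    moreover have "shift p k = Suc k" "shift p (k + 1) = Suc k + 1" "shift p (k + 2) = Suc k + 2"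
      using Suc.prems by (auto simp: shift_def)
    ultimately show ?case using conj_tc[OF permutes_bij[OF s_perm], of k "k + 1" "k + 2"] by simp
  qed
  have T_id: "id \<in> T"
    using mat_subgroupD(2)[OF H] by (simp add: T_def permutes_id perm_mat_eq one_mat_eq)
  have "Alt p \<subseteq> T" by (rule Alt_generated[OF T_id T_comp T_tc]) (use p in auto)
  with \<alpha> show ?thesis by (auto simp: T_def)
qed

section \<open>Monomial matrices acting on column vectors\<close>

lemma mono_mat_mult_vec:
  assumes "\<alpha> permutes {..<p}" "x \<in> carrier_vec p"
  shows "mono_mat p v \<alpha> *\<^sub>v x = vec p (\<lambda>i. v i * x $ (\<alpha> i))"
proof (rule eq_vecI)
  fix i assume "i < dim_vec (vec p (\<lambda>i. v i * x $ (\<alpha> i)))"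
  then have i: "i < p" by simp
  have "(mono_mat p v \<alpha> *\<^sub>v x) $ i = (\<Sum>k\<in>{0..<p}. mono_mat p v \<alpha> $$ (i, k) * x $ k)"
    using i assms(2) by (simp add: mono_mat_def scalar_prod_def)
  also have "\<dots> = (\<Sum>k\<in>{0..<p}. if \<alpha> i = k then v i * x $ k else 0)"
    using i by (intro sum.cong) (auto simp: mono_mat_index)
  also have "\<dots> = v i * x $ (\<alpha> i)"
    using permutes_less[OF assms(1) i] by (simp add: sum.delta)
  finally show "(mono_mat p v \<alpha> *\<^sub>v x) $ i = vec p (\<lambda>i. v i * x $ (\<alpha> i)) $ i"
    using i by simp
qed (simp add: mono_mat_def)

lemma subspace_of_unit_vecs:
  assumes W: "subspace_vec p W" and e: "\<And>i. i < p \<Longrightarrow> unit_vec p i \<in> W"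
  shows "W = carrier_vec p"
proof
  show "W \<subseteq> carrier_vec p" using W by (simp add: subspace_vec_def)
  show "carrier_vec p \<subseteq> W"
  proof
    fix x :: "complex vec" assume x: "x \<in> carrier_vec p"
    have "vec p (\<lambda>j. if j < n then x $ j else 0) \<in> W" if "n \<le> p" for n
      using that
    proof (induction n)
      case 0
      have "vec p (\<lambda>j. if j < 0 then x $ j else 0) = 0\<^sub>v p" by auto
      then show ?case using W by (simp add: subspace_vec_def)
    next
      case (Suc n)
      then have "vec p (\<lambda>j. if j < n then x $ j else 0) + (x $ n) \<cdot>\<^sub>v unit_vec p n \<in> W"
        using W e[of n] by (simp add: subspace_vec_def)
      moreover have "vec p (\<lambda>j. if j < n then x $ j else 0) + (x $ n) \<cdot>\<^sub>v unit_vec p n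
          = vec p (\<lambda>j. if j < Suc n then x $ j else 0)"
        using Suc.prems by (intro eq_vecI) (auto simp: less_Suc_eq)
      ultimately show ?case by simp
    qed
    from this[of p] have "vec p (\<lambda>j. if j < p then x $ j else 0) \<in> W" by simp
    moreover have "vec p (\<lambda>j. if j < p then x $ j else 0) = x" using x by (intro eq_vecI) auto
    ultimately show "x \<in> W" by simp
  qed
qed

section \<open>The extension of a diagonal group by the even permutation matrices\<close>

context diag_group
begin

text \<open>The semidirect product of \<open>A\<close> with the even permutation matrices, as an
  explicit set of normal forms.\<close>

definition Alt_ext :: "complex mat set" where
  "Alt_ext = {mono_mat p v \<alpha> | v \<alpha>. P v \<and> \<alpha> \<in> Alt p}"

lemma Alt_extI: "P v \<Longrightarrow> \<alpha> \<in> Alt p \<Longrightarrow> mono_mat p v \<alpha> \<in> Alt_ext"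
  unfolding Alt_ext_def by blast

lemma Alt_extE:
  assumes "g \<in> Alt_ext"
  obtains v \<alpha> where "g = mono_mat p v \<alpha>" "P v" "\<alpha> \<in> Alt p"
  using assms unfolding Alt_ext_def by blast

lemma Alt_extD:
  assumes "mono_mat p v \<alpha> \<in> Alt_ext" "\<alpha> permutes {..<p}"
  shows "P v" "\<alpha> \<in> Alt p"
proof -
  obtain w \<beta> where w: "mono_mat p v \<alpha> = mono_mat p w \<beta>" "P w" "\<beta> \<in> Alt p"
    using Alt_extE[OF assms(1)] .
  note e = mono_mat_eqD[OF w(1) assms(2) AltD(1)[OF w(3)] P_nonzero[OF w(2)]]
  show "\<alpha> \<in> Alt p" using e(1) w(3) by simp
  show "P v" by (rule P_cong[OF w(2)]) (use e(2) in simp)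
qed

lemma Alt_ext_Mon: "Alt_ext \<subseteq> Mon p"
  using mono_mat_in_Mon AltD(1) P_nonzero by (auto elim!: Alt_extE)

lemma Alt_ext_perm_part: "perm_part p Alt_ext = Alt p"
proof
  show "perm_part p Alt_ext \<subseteq> Alt p" using Alt_extD by (auto simp: perm_part_iff)
  show "Alt p \<subseteq> perm_part p Alt_ext"
  proof
    fix \<alpha> assume "\<alpha> \<in> Alt p"
    then show "\<alpha> \<in> perm_part p Alt_ext"
      using Alt_extI[OF P_one] AltD(1) unfolding perm_part_iff
      by (intro conjI exI[of _ "\<lambda>_. 1"]) simp_all
  qed
qed

lemma Alt_ext_subgroup: "mat_subgroup p Alt_ext"
  unfolding mat_subgroup_def
proof (intro conjI ballI)
  show "Alt_ext \<subseteq> carrier_mat p p" by (auto elim!: Alt_extE)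
  show "1\<^sub>m p \<in> Alt_ext" using Alt_extI[OF P_one Alt_id] by (simp add: one_mat_eq)
next
  fix a b assume "a \<in> Alt_ext" "b \<in> Alt_ext"
  then obtain v \<alpha> w \<beta> where a: "a = mono_mat p v \<alpha>" "P v" "\<alpha> \<in> Alt p"
    and b: "b = mono_mat p w \<beta>" "P w" "\<beta> \<in> Alt p" by (metis Alt_extE)
  have "P (\<lambda>i. v i * (w \<circ> \<alpha>) i)" by (rule P_mult[OF a(2) permutes_invariant[OF b(2) AltD(1)[OF a(3)]]])
  then show "a * b \<in> Alt_ext"
    using Alt_extI Alt_comp[OF b(3) a(3)] by (simp add: a(1) b(1) mono_mat_mult[OF AltD(1)[OF a(3)]])
next
  fix a assume "a \<in> Alt_ext"
  then obtain v \<alpha> where a: "a = mono_mat p v \<alpha>" "P v" "\<alpha> \<in> Alt p" by (metis Alt_extE)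
  note per = AltD(1)[OF a(3)]
  let ?b = "mono_mat p (\<lambda>i. 1 / v (inv_into UNIV \<alpha> i)) (inv_into UNIV \<alpha>)"
  have "P ((\<lambda>i. 1 / v i) \<circ> inv_into UNIV \<alpha>)"
    by (rule permutes_invariant[OF P_inverse[OF a(2)] permutes_inv[OF per]])
  then have b: "?b \<in> Alt_ext"
    using Alt_extI Alt_inv[OF a(3)] by (simp add: comp_def)
  have ba: "?b * a = 1\<^sub>m p" unfolding a(1) by (rule mono_mat_inverse[OF per P_nonzero[OF a(2)]])
  have "a * ?b = 1\<^sub>m p"
    unfolding a(1) mono_mat_mult[OF per] one_mat_eq permutes_inv_o(2)[OF per]
    by (rule mono_mat_cong) (use P_nonzero[OF a(2)] permutes_inverses(2)[OF per] in simp)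
  with b ba show "\<exists>b\<in>Alt_ext. a * b = 1\<^sub>m p \<and> b * a = 1\<^sub>m p" by blast
qed

lemma Alt_ext_finite: "finite Alt_ext"
proof (rule finite_subset)
  show "Alt_ext \<subseteq> (\<lambda>(a, \<alpha>). a * perm_mat p \<alpha>) ` (A \<times> Alt p)"
  proof
    fix g assume "g \<in> Alt_ext"
    then obtain v \<alpha> where g: "g = mono_mat p v \<alpha>" "P v" "\<alpha> \<in> Alt p" by (metis Alt_extE)
    then show "g \<in> (\<lambda>(a, \<alpha>). a * perm_mat p \<alpha>) ` (A \<times> Alt p)"
      by (intro image_eqI[of _ _ "(mono_mat p v id, \<alpha>)"]) (auto simp: diag_mult_perm_mat)
  qed
  show "finite ((\<lambda>(a, \<alpha>). a * perm_mat p \<alpha>) ` (A \<times> Alt p))"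
    using fin finite_Alt by blast
qed

lemma perm_mat_in_Alt_ext: "\<alpha> \<in> Alt p \<Longrightarrow> perm_mat p \<alpha> \<in> Alt_ext"
  using Alt_extI[OF P_one] by (simp add: perm_mat_eq)

lemma A_subset_Alt_ext: "A \<subseteq> Alt_ext"
  using Alt_extI[OF _ Alt_id] in_A_E by (metis subsetI)

text \<open>Oddness of \<open>p\<close> puts \<open>s_mat p\<close> into the extension; conversely
  \<open>s_mat p\<close> and \<open>w_mat p\<close> generate all even permutation matrices.\<close>

lemma gen_group_eq:
  assumes "odd p"
  shows "gen_group p ({s_mat p, w_mat p} \<union> A) = Alt_ext"
proof
  have "{s_mat p, w_mat p} \<union> A \<subseteq> Alt_ext"
    using A_subset_Alt_ext shift_Alt[OF assms] Alt_tc[of 0 1 2 p] p7 perm_mat_in_Alt_ext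
    by (simp add: s_mat_eq w_mat_eq)
  then show "gen_group p ({s_mat p, w_mat p} \<union> A) \<subseteq> Alt_ext"
    unfolding gen_group_def using Alt_ext_subgroup by blast
  show "Alt_ext \<subseteq> gen_group p ({s_mat p, w_mat p} \<union> A)"
    unfolding gen_group_def
  proof (intro subsetI InterI)
    fix g H assume "g \<in> Alt_ext" and "H \<in> {H. mat_subgroup p H \<and> {s_mat p, w_mat p} \<union> A \<subseteq> H}"
    then obtain v \<alpha> where g: "g = mono_mat p v id * perm_mat p \<alpha>" "P v" "\<alpha> \<in> Alt p"
      and H: "mat_subgroup p H" "s_mat p \<in> H" "w_mat p \<in> H" "A \<subseteq> H"
      by (auto elim!: Alt_extE simp: diag_mult_perm_mat)
    then show "g \<in> H"
      using Alt_subset_of_generators[OF H(1-3) _ g(3)] p7 mat_subgroupD(3)[OF H(1)] by auto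
  qed
qed

text \<open>For \<open>x\<close> in an invariant subspace, \<open>(a - 1) (a' - 1) x\<close> is a nonzero multiple of a unit
  vector when \<open>a, a'\<close> have \<open>i\<close> as the only common place with an entry different from 1.\<close>

lemma Alt_ext_irreducible:
  assumes "\<not> A \<subseteq> Scal p"
  shows "irreducible_group p Alt_ext"
  unfolding irreducible_group_def
proof (intro allI impI)
  fix W assume "subspace_vec p W \<and> (\<forall>g\<in>Alt_ext. \<forall>v\<in>W. g *\<^sub>v v \<in> W)"
  then have W: "subspace_vec p W" and inv: "\<And>g v. g \<in> Alt_ext \<Longrightarrow> v \<in> W \<Longrightarrow> g *\<^sub>v v \<in> W" by auto
  have carr: "v \<in> carrier_vec p" if "v \<in> W" for v using W that by (auto simp: subspace_vec_def)
  have smult: "c \<cdot>\<^sub>v v \<in> W" if "v \<in> W" for c v using W that by (auto simp: subspace_vec_def)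
  have diff: "vec p (\<lambda>i. (a i - 1) * x $ i) \<in> W" if a: "P a" and x: "x \<in> W" for a x
  proof -
    have "mono_mat p a id *\<^sub>v x + (-1) \<cdot>\<^sub>v x \<in> W"
      using W inv[OF subsetD[OF A_subset_Alt_ext a] x] smult[OF x] by (simp add: subspace_vec_def)
    moreover have "mono_mat p a id *\<^sub>v x + (-1) \<cdot>\<^sub>v x = vec p (\<lambda>i. (a i - 1) * x $ i)"
      using carr[OF x] unfolding mono_mat_mult_vec[OF permutes_id carr[OF x]]
      by (intro eq_vecI) (auto simp: algebra_simps)
    ultimately show ?thesis by simp
  qed
  have "W = carrier_vec p" if "W \<noteq> {0\<^sub>v p}"
  proof -
    have "0\<^sub>v p \<in> W" using W by (simp add: subspace_vec_def)
    with that obtain x where x: "x \<in> W" "x \<noteq> 0\<^sub>v p" by blast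
    then obtain i where i: "i < p" "x $ i \<noteq> 0"
      using carr[OF x(1)] by (metis carrier_vecD eq_vecI index_zero_vec(1) index_zero_vec(2))
    obtain u where u: "u \<in> U" "u \<noteq> 1" using U_nontrivial[OF assms] .
    obtain k where k: "k < p" "k \<notin> set [i]"
      by (rule ex_fresh_list[of "[i]" p]) (use p7 in auto)
    obtain l where l: "l < p" "l \<notin> set [i, k]"
      by (rule ex_fresh_list[of "[i, k]" p]) (use p7 in auto)
    define y where "y = vec p (\<lambda>j. (pair_diag i k u j - 1) * x $ j)"
    define z where "z = vec p (\<lambda>j. (pair_diag i l u j - 1) * y $ j)"
    have "y \<in> W" unfolding y_def by (rule diff[OF U_D x(1)]) (use u i k in auto)
    then have "z \<in> W" unfolding z_def by (intro diff[OF U_D]) (use u i l in auto)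
    \<comment> \<open>Both differences contribute the factor \<open>u - 1\<close> at
      \<open>i\<close>, and at every other place at least one of them is 0.\<close>
    then have "(1 / ((u - 1)^2 * x $ i)) \<cdot>\<^sub>v z \<in> W" by (rule smult)
    moreover have "(1 / ((u - 1)^2 * x $ i)) \<cdot>\<^sub>v z = unit_vec p i"
      using u(2) i k l by (intro eq_vecI) (auto simp: z_def y_def pair_diag_def power2_eq_square)
    ultimately have e: "unit_vec p i \<in> W" by simp
    have "unit_vec p j \<in> W" if "j < p" for j
    proof (cases "j = i")
      case False
      obtain m where m: "m < p" "m \<notin> set [i, j]"
        by (rule ex_fresh_list[of "[i, j]" p]) (use p7 in auto)
      \<comment> \<open>The \<open>j\<close>-th coordinate of the image is the old coordinate at the
        image of \<open>j\<close>, so the cycle must send \<open>j\<close> to \<open>i\<close>;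
        \<open>m\<close> merely makes the permutation even.\<close>
      have t: "tc j i m \<in> Alt p" by (rule Alt_tc) (use False that m i in auto)
      have "perm_mat p (tc j i m) *\<^sub>v unit_vec p i \<in> W"
        by (rule inv[OF perm_mat_in_Alt_ext[OF t] e])
      moreover have "perm_mat p (tc j i m) *\<^sub>v unit_vec p i = unit_vec p j"
        unfolding perm_mat_eq mono_mat_mult_vec[OF AltD(1)[OF t] unit_vec_carrier]
        by (rule eq_vecI) (use False that m i in \<open>auto simp: tc_def\<close>)
      ultimately show ?thesis by simp
    qed (use e in simp)
    then show ?thesis by (rule subspace_of_unit_vecs[OF W])
  qed
  then show "W = {0\<^sub>v p} \<or> W = carrier_vec p" by blast
qed

end

text \<open>Conjugating a diagonal matrix by \<open>perm_mat p \<alpha>\<close> precomposes its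
  entries with \<open>\<alpha>\<close>, so the invariance specialises to 3-cycles.\<close>

lemma admissible_diag_group:
  assumes "admissible p A" "7 \<le> p"
  shows "diag_group p A"
proof
  show "mono_mat p (v \<circ> tc a b c) id \<in> A"
    if t: "distinct [a, b, c]" "{a, b, c} \<subseteq> {..<p}" and v: "mono_mat p v id \<in> A" for a b c v
  proof -
    have per: "tc a b c permutes {..<p}" by (rule tc_permutes[OF t])
    then have "perm_mat p (tc a b c) * mono_mat p v id * perm_mat p (inv_into UNIV (tc a b c)) \<in> A"
      using assms(1) v unfolding admissible_def by blast
    then show ?thesis
      using per by (simp add: perm_mat_eq mono_mat_mult permutes_inv_o comp_def[of v])
  qed
qed (use assms in \<open>auto simp: admissible_def\<close>)

section \<open>Monomial groups with alternating permutation part\<close>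

lemma complex_root_exists:
  assumes "0 < n"
  obtains w :: complex where "w ^ n = z"
proof
  show "(rcis (root n (cmod z)) (Arg z / real n)) ^ n = z"
    using assms by (simp add: DeMoivre2 rcis_cmod_Arg)
qed

locale alternating_mono_group =
  fixes p :: nat and G :: "complex mat set"
  assumes p7: "7 \<le> p"
    and fin: "finite G"
    and subgroup: "mat_subgroup p G"
    and mon: "G \<subseteq> Mon p"
    and part: "perm_part p G = Alt p"
begin

definition M :: "(nat \<Rightarrow> complex) \<Rightarrow> (nat \<Rightarrow> nat) \<Rightarrow> bool" where
  "M v \<alpha> \<longleftrightarrow> \<alpha> permutes {..<p} \<and> mono_mat p v \<alpha> \<in> G"

lemma M_nonzero: "M v \<alpha> \<Longrightarrow> i < p \<Longrightarrow> v i \<noteq> 0"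
  unfolding M_def using mono_mat_in_MonD mon by blast

lemma M_Alt: "M v \<alpha> \<Longrightarrow> \<alpha> \<in> Alt p"
  using M_nonzero unfolding part[symmetric] perm_part_iff by (auto simp: M_def)

sublocale M: mono_system p M
proof
  show "\<exists>v. M v \<alpha>" if "\<alpha> \<in> Alt p" for \<alpha>
    using that unfolding part[symmetric] perm_part_iff M_def by blast
  show "M (\<lambda>i. v i * w (\<alpha> i)) (\<beta> \<circ> \<alpha>)" if "M v \<alpha>" "M w \<beta>" for v w \<alpha> \<beta>
    using that mat_subgroupD(3)[OF subgroup, of "mono_mat p v \<alpha>" "mono_mat p w \<beta>"]
    unfolding M_def by (auto simp: mono_mat_mult intro: permutes_compose)
  show "M (\<lambda>i. 1 / v (inv_into UNIV \<alpha> i)) (inv_into UNIV \<alpha>)" if "M v \<alpha>" for v \<alpha>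
    using that mono_mat_inverse_in[OF subgroup, of v \<alpha>] M_nonzero[OF that] permutes_inv
    unfolding M_def by blast
  show "M w \<alpha>" if "M v \<alpha>" "\<And>i. i < p \<Longrightarrow> v i = w i" for v w \<alpha>
    using that mono_mat_cong[of p v w \<alpha>] unfolding M_def by simp
qed (use p7 M_nonzero M_Alt in auto)

definition diag_part :: "complex mat set" where "diag_part = G \<inter> Diag p"

lemma diag_part_iff: "mono_mat p v id \<in> diag_part \<longleftrightarrow> M v id"
proof -
  have "\<forall>i<p. v i \<noteq> 0" if "M v id" using M_nonzero[OF that] by blast
  then show ?thesis
    unfolding diag_part_def Int_iff mono_mat_in_Diag unfolding M_def using permutes_id by blast
qed

sublocale D: diag_group p diag_part
proof
  show "mat_subgroup p diag_part"
    unfolding mat_subgroup_def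
  proof (intro conjI ballI)
    show "diag_part \<subseteq> carrier_mat p p" using mat_subgroupD(1)[OF subgroup] by (auto simp: diag_part_def)
    show "1\<^sub>m p \<in> diag_part" using mat_subgroupD(2)[OF subgroup] by (auto simp: diag_part_def one_mat_eq mono_mat_in_Diag)
  next
    fix a b assume ab: "a \<in> diag_part" "b \<in> diag_part"
    then obtain v w where v: "a = mono_mat p v id" "b = mono_mat p w id" by (metis diag_part_def DiagE IntE)
    then have "M v id" "M w id" using ab diag_part_iff by blast+
    from M.mult[OF this] have "M (\<lambda>i. v i * w i) id" by (simp only: id_apply comp_id)
    then show "a * b \<in> diag_part" unfolding v diag_part_iff[symmetric] by (simp add: mono_mat_mult permutes_id)
  next
    fix a assume a: "a \<in> diag_part"
    then obtain v where v: "a = mono_mat p v id" by (metis diag_part_def DiagE IntE)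
    have m: "M v id" using a v diag_part_iff by blast
    have "M (\<lambda>i. 1 / v i) id" using M.inverse[OF m] by (simp add: inv_id)
    moreover have "a * mono_mat p (\<lambda>i. 1 / v i) id = 1\<^sub>m p"
      using M_nonzero[OF m] unfolding v mono_mat_mult[OF permutes_id] one_mat_eq comp_id
      by (intro mono_mat_cong) simp
    moreover have "mono_mat p (\<lambda>i. 1 / v i) id * a = 1\<^sub>m p"
      using M_nonzero[OF m] unfolding v mono_mat_mult[OF permutes_id] one_mat_eq comp_id
      by (intro mono_mat_cong) simp
    ultimately show "\<exists>b\<in>diag_part. a * b = 1\<^sub>m p \<and> b * a = 1\<^sub>m p" using diag_part_iff by blast
  qed
  show "mono_mat p (v \<circ> tc a b c) id \<in> diag_part"
    if t: "distinct [a, b, c]" "{a, b, c} \<subseteq> {..<p}" and v: "mono_mat p v id \<in> diag_part" for a b c v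
  proof -
    \<comment> \<open>The permutation matrix of the cycle is not known to lie in \<open>G\<close>,
      so an arbitrary element over it is used: its entries cancel in the quotient.\<close>
    obtain w where w: "M w (tc a b c)" using M.surj_Alt[OF Alt_tc[OF t]] by blast
    have "M (\<lambda>i. w i * v (tc a b c i)) (id \<circ> tc a b c)" using M.mult[OF w] v diag_part_iff by blast
    then have "M (\<lambda>i. w i * v (tc a b c i)) (tc a b c)" by (simp only: id_comp)
    from M.quot_same[OF w this] show ?thesis
      unfolding diag_part_iff by (rule M.cong) (use M_nonzero[OF w] in simp)
  qed
qed (use fin p7 in \<open>auto simp: diag_part_def\<close>)

text \<open>Entrywise powers with exponent \<open>card D.U\<close> respect monomial products and
  send all ratios in \<open>D.U\<close> to 1, so the diagonal members become scalar and the cocycle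
  results apply.\<close>

definition N :: "(nat \<Rightarrow> complex) \<Rightarrow> (nat \<Rightarrow> nat) \<Rightarrow> bool" where
  "N x \<alpha> \<longleftrightarrow> (\<exists>v. M v \<alpha> \<and> (\<forall>i<p. x i = v i ^ card D.U))"

sublocale N: scalar_mono_system p N
proof
  have lt: "\<alpha> i < p" if "M v \<alpha>" "i < p" for v \<alpha> i
    using permutes_less that by (auto simp: M_def)
  show "x i \<noteq> 0" if "N x \<alpha>" "i < p" for x \<alpha> i
    using that M_nonzero by (auto simp: N_def)
  show "\<exists>x. N x \<alpha>" if "\<alpha> \<in> Alt p" for \<alpha>
    using M.surj_Alt[OF that] by (auto simp: N_def)
  show "N (\<lambda>i. x i * y (\<alpha> i)) (\<beta> \<circ> \<alpha>)" if xy: "N x \<alpha>" "N y \<beta>" for x y \<alpha> \<beta>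
  proof -
    obtain v w where v: "M v \<alpha>" "\<forall>i<p. x i = v i ^ card D.U" "M w \<beta>" "\<forall>i<p. y i = w i ^ card D.U"
      using xy unfolding N_def by blast
    then have "\<forall>i<p. x i * y (\<alpha> i) = (v i * w (\<alpha> i)) ^ card D.U"
      using lt by (simp add: power_mult_distrib)
    then show ?thesis unfolding N_def using M.mult[OF v(1,3)] by blast
  qed
  show "N (\<lambda>i. 1 / x (inv_into UNIV \<alpha> i)) (inv_into UNIV \<alpha>)" if x: "N x \<alpha>" for x \<alpha>
  proof -
    obtain v where v: "M v \<alpha>" "\<forall>i<p. x i = v i ^ card D.U"
      using x unfolding N_def by blast
    then have "\<forall>i<p. 1 / x (inv_into UNIV \<alpha> i) = (1 / v (inv_into UNIV \<alpha> i)) ^ card D.U"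
      using lt[OF M.inverse[OF v(1)]] by (simp add: power_one_over)
    then show ?thesis unfolding N_def using M.inverse[OF v(1)] by blast
  qed
  show "x i = x j" if "N x id" "i < p" "j < p" for x i j
  proof -
    obtain v where v: "M v id" "\<And>i. i < p \<Longrightarrow> x i = v i ^ card D.U"
      using \<open>N x id\<close> unfolding N_def by blast
    show ?thesis
      using D.ratio_power[OF _ \<open>i < p\<close> \<open>j < p\<close>, of v] v that(2,3) diag_part_iff by simp
  qed
qed (use p7 M_Alt in \<open>auto simp: N_def\<close>)

text \<open>The commutators of elements whose entries are constant modulo \<open>D.U\<close> have entries in \<open>D.U\<close>
  with product 1, so they agree with permutation matrices modulo \<open>diag_part\<close>.\<close>

lemma perm_mats_in:
  assumes const: "\<And>v \<alpha>. M v \<alpha> \<Longrightarrow> \<exists>z. \<forall>i<p. v i ^ card D.U = z"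
    and \<kappa>: "\<kappa> \<in> Alt p"
  shows "perm_mat p \<kappa> \<in> G"
proof -
  define T where "T = {\<kappa>. M (\<lambda>_. 1) \<kappa>}"
  have "Alt p \<subseteq> T"
  proof (rule Alt_generated)
    show "id \<in> T" using D.P_one diag_part_iff by (simp add: T_def)
    show "\<alpha> \<circ> \<beta> \<in> T" if "\<alpha> \<in> T" "\<beta> \<in> T" for \<alpha> \<beta>
      using M.mult[of "\<lambda>_. 1" \<beta> "\<lambda>_. 1" \<alpha>] that by (simp add: T_def)
    fix k assume k: "k + 2 < p"
    define \<kappa> where "\<kappa> = tc k (k + 1) (k + 2)"
    obtain a where a: "a < p" "a \<notin> set [k, k + 1, k + 2]"
      by (rule ex_fresh_list[of "[k, k + 1, k + 2]" p]) (use p7 in auto)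
    obtain b where b: "b < p" "b \<notin> set [k, k + 1, k + 2, a]"
      by (rule ex_fresh_list[of "[k, k + 1, k + 2, a]" p]) (use p7 in auto)
    define \<alpha> where "\<alpha> = tc k (k + 1) a"
    define \<beta> where "\<beta> = tc (k + 1) b (k + 2)"
    have ab: "\<alpha> \<in> Alt p" "\<beta> \<in> Alt p" "\<kappa> \<in> Alt p"
      unfolding \<alpha>_def \<beta>_def \<kappa>_def using k a b by (auto intro!: Alt_tc)
    have comm: "\<alpha> \<circ> (\<beta> \<circ> \<kappa>) = \<beta> \<circ> \<alpha>"
      unfolding \<alpha>_def \<beta>_def \<kappa>_def by (rule tc_commutator) (use a b in auto)
    obtain v w where v: "M v \<alpha>" and w: "M w \<beta>" using M.surj_Alt ab by blast
    define y where "y = (\<lambda>i. v i * w (\<alpha> i) / (w (\<kappa> i) * v (\<beta> (\<kappa> i))))"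
    have y: "M y \<kappa>" unfolding y_def by (rule M.commutator[OF v w comm])
    have lt: "\<gamma> i < p" if "\<gamma> \<in> Alt p" "i < p" for \<gamma> i using permutes_less AltD(1) that by blast
    have yU: "y i \<in> D.U" if "i < p" for i
    proof -
      obtain z where z: "v j ^ card D.U = z" if "j < p" for j using const[OF v] by blast
      obtain z' where z': "w j ^ card D.U = z'" if "j < p" for j using const[OF w] by blast
      have "y i ^ card D.U = (z * z') / (z' * z)"
        using that lt ab by (simp add: y_def power_mult_distrib power_divide z z')
      moreover have "z \<noteq> 0" "z' \<noteq> 0" using z[OF that] z'[OF that] M_nonzero[OF v that] M_nonzero[OF w that] by auto
      ultimately have "y i ^ card D.U = 1" by simp
      then show ?thesis using D.U_roots by blast
    qed
    have perm: "(\<Prod>i<p. f (\<gamma> i)) = (\<Prod>i<p. f i)" if "\<gamma> \<in> Alt p" for f :: "nat \<Rightarrow> complex" and \<gamma>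
      using prod.permute[OF AltD(1)[OF that], of f] by (simp add: o_def)
    have perm2: "(\<Prod>i<p. v (\<beta> (\<kappa> i))) = (\<Prod>i<p. v i)"
      using perm[OF Alt_comp[OF ab(2,3)], of v] by simp
    have "(\<Prod>i<p. v i) \<noteq> 0" "(\<Prod>i<p. w i) \<noteq> 0" using M_nonzero[OF v] M_nonzero[OF w] by auto
    then have prod: "(\<Prod>i<p. y i) = 1"
      unfolding y_def prod_dividef prod.distrib perm2 perm[OF ab(1), of w] perm[OF ab(3), of w] by simp
    have "M y id" using D.P_prod_one[OF yU prod] unfolding diag_part_iff .
    from M.mult[OF M.inverse[OF \<open>M y id\<close>] y] have "M (\<lambda>i. 1 / y i * y i) \<kappa>"
      by (simp add: inv_id)
    then have "M (\<lambda>_. 1) \<kappa>" by (rule M.cong) (use M_nonzero[OF y] in simp)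
    then show "tc k (k + 1) (k + 2) \<in> T" by (simp add: T_def \<kappa>_def)
  qed (use p7 in simp)
  then show ?thesis using \<kappa> by (auto simp: T_def M_def perm_mat_eq)
qed

text \<open>Dividing a member by the permutation matrix under it leaves a member of
  \<open>diag_part\<close>.\<close>

lemma eq_Alt_ext:
  assumes "\<And>\<kappa>. \<kappa> \<in> Alt p \<Longrightarrow> perm_mat p \<kappa> \<in> G"
  shows "G = D.Alt_ext"
proof
  have one: "M (\<lambda>_. 1) \<alpha>" if "\<alpha> \<in> Alt p" for \<alpha>
    using assms[OF that] AltD(1)[OF that] by (simp add: M_def perm_mat_eq)
  show "G \<subseteq> D.Alt_ext"
  proof
    fix g assume g: "g \<in> G"
    then obtain v \<alpha> where v: "g = mono_mat p v \<alpha>" "\<alpha> permutes {..<p}" using mon by (metis MonE subsetD)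
    then have m: "M v \<alpha>" using g by (simp add: M_def)
    have "M (\<lambda>i. v i / 1) id" using M.quot_same[OF one[OF M_Alt[OF m]] m] .
    then have "mono_mat p v id \<in> diag_part" unfolding diag_part_iff by simp
    then show "g \<in> D.Alt_ext" unfolding v(1) by (rule D.Alt_extI[OF _ M_Alt[OF m]])
  qed
  show "D.Alt_ext \<subseteq> G"
  proof
    fix g assume "g \<in> D.Alt_ext"
    then obtain v \<alpha> where g: "g = mono_mat p v id * perm_mat p \<alpha>" "mono_mat p v id \<in> diag_part" "\<alpha> \<in> Alt p"
      by (auto elim!: D.Alt_extE simp: diag_mult_perm_mat)
    then show "g \<in> G" using assms mat_subgroupD(3)[OF subgroup] by (simp add: diag_part_def)
  qed
qed

text \<open>Otherwise \<open>G\<close> would consist of scalar multiples of permutation matrices,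
  which preserve the line of constant vectors.\<close>

lemma not_scalar:
  assumes perms: "\<And>\<kappa>. \<kappa> \<in> Alt p \<Longrightarrow> perm_mat p \<kappa> \<in> G" and irr: "irreducible_group p G"
  shows "\<not> diag_part \<subseteq> Scal p"
proof
  assume sc: "diag_part \<subseteq> Scal p"
  define W where "W = {vec p (\<lambda>_. c) | c :: complex. True}"
  have W: "subspace_vec p W"
    unfolding subspace_vec_def
  proof (intro conjI ballI allI)
    show "0\<^sub>v p \<in> W" unfolding W_def by (auto intro!: exI[of _ 0])
    show "u + v \<in> W" if "u \<in> W" "v \<in> W" for u v
    proof -
      from that obtain c d where "u = vec p (\<lambda>_. c)" "v = vec p (\<lambda>_. d)" by (auto simp: W_def)
      then have "u + v = vec p (\<lambda>_. c + d)" by auto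
      then show ?thesis by (auto simp: W_def)
    qed
    show "a \<cdot>\<^sub>v v \<in> W" if "v \<in> W" for a v
    proof -
      from that obtain c where "v = vec p (\<lambda>_. c)" by (auto simp: W_def)
      then have "a \<cdot>\<^sub>v v = vec p (\<lambda>_. a * c)" by auto
      then show ?thesis by (auto simp: W_def)
    qed
  qed (auto simp: W_def)
  have inv: "g *\<^sub>v x \<in> W" if "g \<in> G" "x \<in> W" for g x
  proof -
    obtain v \<alpha> where g: "g = mono_mat p v \<alpha>" "mono_mat p v id \<in> diag_part" "\<alpha> \<in> Alt p"
      using \<open>g \<in> G\<close> eq_Alt_ext[OF perms] by (metis D.Alt_extE)
    obtain c where c: "x = vec p (\<lambda>_. c)" using \<open>x \<in> W\<close> by (auto simp: W_def)
    obtain z where z: "mono_mat p v id = z \<cdot>\<^sub>m 1\<^sub>m p" using sc g(2) by (auto simp: Scal_def)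
    have "v i = z" if "i < p" for i
    proof -
      have "mono_mat p v id $$ (i, i) = (z \<cdot>\<^sub>m 1\<^sub>m p) $$ (i, i)" by (simp add: z)
      then show ?thesis using that by (simp add: mono_mat_index)
    qed
    then have "g *\<^sub>v x = vec p (\<lambda>_. z * c)"
      unfolding g(1) c mono_mat_mult_vec[OF AltD(1)[OF g(3)] vec_carrier]
      using permutes_less[OF AltD(1)[OF g(3)]] by (intro eq_vecI) auto
    then show ?thesis by (auto simp: W_def)
  qed
  have one: "vec p (\<lambda>_. 1) \<in> W" by (auto simp: W_def)
  have "W \<noteq> {0\<^sub>v p}"
  proof
    assume "W = {0\<^sub>v p}"
    then have "vec p (\<lambda>_. 1 :: complex) $ 0 = 0\<^sub>v p $ 0" using one by simp
    then show False using p7 by simp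
  qed
  moreover have "W \<noteq> carrier_vec p"
  proof
    assume "W = carrier_vec p"
    then have "unit_vec p 0 \<in> W" by simp
    then obtain c :: complex where c: "unit_vec p 0 = vec p (\<lambda>_. c)" by (auto simp: W_def)
    then have "unit_vec p 0 $ 0 = vec p (\<lambda>_. c) $ 0" "unit_vec p 0 $ 1 = vec p (\<lambda>_. c) $ 1" by simp_all
    then show False using p7 by simp
  qed
  ultimately show False using irr W inv unfolding irreducible_group_def by blast
qed

lemma admissible_diag_part:
  assumes "\<not> diag_part \<subseteq> Scal p"
  shows "admissible p diag_part"
  unfolding admissible_def using D.fin D.subgroup D.diag D.perm_conj_in assms by blast

end

section \<open>Conjugation into split form\<close>

lemma conj_mat_mult:
  assumes "X \<in> carrier_mat p p" "Y \<in> carrier_mat p p" "a \<in> carrier_mat p p" "b \<in> carrier_mat p p"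
    and YX: "Y * X = 1\<^sub>m p"
  shows "(X * a * Y) * (X * b * Y) = X * (a * b) * (Y :: 'a :: comm_ring_1 mat)"
proof -
  have "(X * a * Y) * (X * b * Y) = X * a * ((Y * X) * (b * Y))"
    using assms(1-4) by (simp add: assoc_mult_mat[where n\<^sub>1 = p and n\<^sub>2 = p and n\<^sub>3 = p and n\<^sub>4 = p])
  also have "\<dots> = X * a * (b * Y)" using assms by simp
  also have "\<dots> = X * (a * b) * Y"
    using assms(1-4) by (simp add: assoc_mult_mat[where n\<^sub>1 = p and n\<^sub>2 = p and n\<^sub>3 = p and n\<^sub>4 = p])
  finally show ?thesis .
qed

lemma conj_mat_cancel:
  assumes "X \<in> carrier_mat p p" "Y \<in> carrier_mat p p" "a \<in> carrier_mat p p"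
    and YX: "Y * X = 1\<^sub>m p"
  shows "Y * (X * a * Y) * X = (a :: 'a :: comm_ring_1 mat)"
proof -
  have "Y * (X * a * Y) * X = (Y * X) * a * (Y * X)"
    using assms(1-3) by (simp add: assoc_mult_mat[where n\<^sub>1 = p and n\<^sub>2 = p and n\<^sub>3 = p and n\<^sub>4 = p])
  then show ?thesis using assms by simp
qed

lemma mat_subgroup_conj:
  assumes X: "X \<in> carrier_mat p p" and Y: "Y \<in> carrier_mat p p"
    and XY: "X * Y = 1\<^sub>m p" and YX: "Y * X = 1\<^sub>m p" and G: "mat_subgroup p G"
  shows "mat_subgroup p {X * g * Y | g. g \<in> G}"
  unfolding mat_subgroup_def
proof (intro conjI ballI)
  note carr = subsetD[OF mat_subgroupD(1)[OF G]]
  show "{X * g * Y | g. g \<in> G} \<subseteq> carrier_mat p p" using X Y carr by auto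
  have one: "X * 1\<^sub>m p * Y = 1\<^sub>m p" using X XY by simp
  then show "1\<^sub>m p \<in> {X * g * Y | g. g \<in> G}" using mat_subgroupD(2)[OF G] by (auto intro!: exI[of _ "1\<^sub>m p"])
  fix a assume "a \<in> {X * g * Y | g. g \<in> G}"
  then obtain g where g: "a = X * g * Y" "g \<in> G" by blast
  show "a * b \<in> {X * g * Y | g. g \<in> G}" if "b \<in> {X * g * Y | g. g \<in> G}" for b
  proof -
    obtain h where h: "b = X * h * Y" "h \<in> G" using \<open>b \<in> _\<close> by blast
    show ?thesis
      using conj_mat_mult[OF X Y carr[OF g(2)] carr[OF h(2)] YX] mat_subgroupD(3)[OF G g(2) h(2)] g h
      by blast
  qed
  obtain h where h: "h \<in> G" "g * h = 1\<^sub>m p" "h * g = 1\<^sub>m p"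
    using G g(2) unfolding mat_subgroup_def by blast
  have "a * (X * h * Y) = 1\<^sub>m p" "(X * h * Y) * a = 1\<^sub>m p"
    using conj_mat_mult[OF X Y carr[OF g(2)] carr[OF h(1)] YX]
      conj_mat_mult[OF X Y carr[OF h(1)] carr[OF g(2)] YX] h one g by simp_all
  then show "\<exists>b\<in>{X * g * Y | g. g \<in> G}. a * b = 1\<^sub>m p \<and> b * a = 1\<^sub>m p"
    using h(1) by blast
qed

lemma irreducible_group_conj:
  assumes X: "X \<in> carrier_mat p p" and Y: "Y \<in> carrier_mat p p"
    and XY: "X * Y = 1\<^sub>m p" and YX: "Y * X = 1\<^sub>m p" and G: "G \<subseteq> carrier_mat p p"
    and irr: "irreducible_group p G"
  shows "irreducible_group p {X * g * Y | g. g \<in> G}"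
  unfolding irreducible_group_def
proof (intro allI impI)
  fix W assume "subspace_vec p W \<and> (\<forall>g\<in>{X * g * Y | g. g \<in> G}. \<forall>v\<in>W. g *\<^sub>v v \<in> W)"
  then have W: "subspace_vec p W" and inv: "\<And>g v. g \<in> G \<Longrightarrow> v \<in> W \<Longrightarrow> (X * g * Y) *\<^sub>v v \<in> W"
    by blast+
  have carr: "v \<in> carrier_vec p" if "v \<in> W" for v using W that by (auto simp: subspace_vec_def)
  have XYv: "X *\<^sub>v (Y *\<^sub>v v) = v" "Y *\<^sub>v (X *\<^sub>v v) = v" if "v \<in> carrier_vec p" for v
    using assoc_mult_mat_vec[OF X Y that] assoc_mult_mat_vec[OF Y X that] XY YX that by simp_all
  have Y0: "Y *\<^sub>v 0\<^sub>v p = 0\<^sub>v p" and X0: "X *\<^sub>v 0\<^sub>v p = 0\<^sub>v p"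
    using X Y by (auto intro!: eq_vecI simp: scalar_prod_def)
  \<comment> \<open>An invariant subspace \<open>W\<close> of the conjugate group corresponds to the
    subspace \<open>Y W\<close>, which is invariant under \<open>G\<close>.\<close>
  define W' where "W' = (*\<^sub>v) Y ` W"
  have "subspace_vec p W'"
    unfolding subspace_vec_def W'_def
  proof (intro conjI ballI allI)
    show "(*\<^sub>v) Y ` W \<subseteq> carrier_vec p" using Y carr by auto
    show "0\<^sub>v p \<in> (*\<^sub>v) Y ` W"
      using W Y0 unfolding subspace_vec_def by (metis image_eqI)
    show "u + v \<in> (*\<^sub>v) Y ` W" if "u \<in> (*\<^sub>v) Y ` W" "v \<in> (*\<^sub>v) Y ` W" for u v
    proof -
      from that obtain u' v' where u: "u = Y *\<^sub>v u'" "u' \<in> W" "v = Y *\<^sub>v v'" "v' \<in> W" by blast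
      then have "u + v = Y *\<^sub>v (u' + v')" "u' + v' \<in> W"
        using mult_add_distrib_mat_vec[OF Y carr[OF u(2)] carr[OF u(4)]] W
        by (auto simp: subspace_vec_def)
      then show ?thesis by blast
    qed
    show "c \<cdot>\<^sub>v v \<in> (*\<^sub>v) Y ` W" if "v \<in> (*\<^sub>v) Y ` W" for c v
    proof -
      from that obtain v' where v: "v = Y *\<^sub>v v'" "v' \<in> W" by blast
      then have "c \<cdot>\<^sub>v v = Y *\<^sub>v (c \<cdot>\<^sub>v v')" "c \<cdot>\<^sub>v v' \<in> W"
        using mult_mat_vec[OF Y carr[OF v(2)]] W by (auto simp: subspace_vec_def)
      then show ?thesis by blast
    qed
  qed
  moreover have "g *\<^sub>v v \<in> W'" if g: "g \<in> G" and v: "v \<in> W'" for g v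
  proof -
    obtain w where w: "v = Y *\<^sub>v w" "w \<in> W" using v by (auto simp: W'_def)
    have gc: "g \<in> carrier_mat p p" and wc: "w \<in> carrier_vec p" using G g carr w by auto
    have "(X * g * Y) *\<^sub>v w = X *\<^sub>v (g *\<^sub>v (Y *\<^sub>v w))"
      using X Y gc wc by (simp add: assoc_mult_mat_vec[where n\<^sub>1 = p and n\<^sub>2 = p and n\<^sub>3 = p])
    then have "Y *\<^sub>v ((X * g * Y) *\<^sub>v w) = g *\<^sub>v v"
      using XYv(2)[of "g *\<^sub>v (Y *\<^sub>v w)"] Y gc wc w by simp
    then show ?thesis unfolding W'_def using inv[OF g w(2)] by (metis image_eqI)
  qed
  ultimately have "W' = {0\<^sub>v p} \<or> W' = carrier_vec p" using irr unfolding irreducible_group_def by blast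
  then show "W = {0\<^sub>v p} \<or> W = carrier_vec p"
  proof
    assume W': "W' = {0\<^sub>v p}"
    have "w = 0\<^sub>v p" if "w \<in> W" for w
    proof -
      have "Y *\<^sub>v w = 0\<^sub>v p" using W' that unfolding W'_def by blast
      then show ?thesis using XYv(1)[OF carr[OF that]] X0 by simp
    qed
    then show ?thesis using W by (auto simp: subspace_vec_def)
  next
    assume W': "W' = carrier_vec p"
    have "v \<in> W" if v: "v \<in> carrier_vec p" for v
    proof -
      have "Y *\<^sub>v v \<in> W'" using W' Y v by simp
      then obtain w where "Y *\<^sub>v v = Y *\<^sub>v w" "w \<in> W" unfolding W'_def by blast
      then show ?thesis using XYv(1)[OF v] XYv(1)[OF carr] by metis
    qed
    then show ?thesis using carr by blast
  qed
qed

lemma mono_diag_conj: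
  assumes "\<alpha> permutes {..<p}"
  shows "mono_mat p d id * mono_mat p v \<alpha> * mono_mat p (\<lambda>i. 1 / d i) id =
    mono_mat p (\<lambda>i. d i * v i / d (\<alpha> i)) \<alpha>"
  using assms by (simp add: mono_mat_mult permutes_id)

context alternating_mono_group
begin

text \<open>Diagonal conjugation stays within the setting. The formula for \<open>M\<close> undoes
  the conjugation, expressing members of \<open>G'\<close> through members of
  \<open>G\<close>.\<close>

lemma diag_conj:
  assumes d: "\<And>i. i < p \<Longrightarrow> d i \<noteq> 0"
  defines "G' \<equiv> {mono_mat p d id * g * mono_mat p (\<lambda>i. 1 / d i) id | g. g \<in> G}"
  shows "alternating_mono_group p G'"
    and "alternating_mono_group.M p G' v \<alpha> \<longleftrightarrow> M (\<lambda>i. v i * d (\<alpha> i) / d i) \<alpha>"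
    and "irreducible_group p G \<Longrightarrow> irreducible_group p G'"
    and "GL_conj p G G'"
proof -
  let ?X = "mono_mat p d id" and ?Y = "mono_mat p (\<lambda>i. 1 / d i) id"
  have XY: "?X * ?Y = 1\<^sub>m p" "?Y * ?X = 1\<^sub>m p"
    unfolding mono_mat_mult[OF permutes_id] one_mat_eq comp_id using d by (auto intro!: mono_mat_cong)
  show GL: "GL_conj p G G'"
    unfolding GL_conj_def G'_def using XY mono_mat_carrier by blast
  show "irreducible_group p G \<Longrightarrow> irreducible_group p G'"
    unfolding G'_def by (rule irreducible_group_conj) (use XY mat_subgroupD(1)[OF subgroup] in auto)
  have elem: "mono_mat p v \<alpha> \<in> G' \<longleftrightarrow> M (\<lambda>i. v i * d (\<alpha> i) / d i) \<alpha>"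
    if \<alpha>: "\<alpha> permutes {..<p}" for v \<alpha>
  proof
    have lt: "\<alpha> i < p" if "i < p" for i using permutes_less[OF \<alpha> that] .
    assume "mono_mat p v \<alpha> \<in> G'"
    then obtain g where g: "mono_mat p v \<alpha> = ?X * g * ?Y" "g \<in> G" unfolding G'_def by blast
    obtain w \<beta> where w: "g = mono_mat p w \<beta>" "\<beta> permutes {..<p}" using g(2) mon by (metis MonE subsetD)
    have m: "M w \<beta>" using w g by (simp add: M_def)
    have "mono_mat p v \<alpha> = mono_mat p (\<lambda>i. d i * w i / d (\<beta> i)) \<beta>"
      using g(1) mono_diag_conj[OF w(2)] w(1) by simp
    note e = mono_mat_eqD[OF this \<alpha> w(2)]
    have nz: "d i * w i / d (\<beta> i) \<noteq> 0" if "i < p" for i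
      using d[OF that] d[OF permutes_less[OF w(2) that]] M_nonzero[OF m that] by simp
    have [simp]: "\<beta> = \<alpha>" using e(1)[OF nz] by simp
    show "M (\<lambda>i. v i * d (\<alpha> i) / d i) \<alpha>"
    proof (rule M.cong)
      show "M w \<alpha>" using m by simp
      show "w i = v i * d (\<alpha> i) / d i" if "i < p" for i
        using e(2)[OF nz that] d[OF that] d[OF lt[OF that]] by simp
    qed
  next
    have lt: "\<alpha> i < p" if "i < p" for i using permutes_less[OF \<alpha> that] .
    assume "M (\<lambda>i. v i * d (\<alpha> i) / d i) \<alpha>"
    then have "?X * mono_mat p (\<lambda>i. v i * d (\<alpha> i) / d i) \<alpha> * ?Y \<in> G'"
      unfolding G'_def M_def by blast
    moreover have "?X * mono_mat p (\<lambda>i. v i * d (\<alpha> i) / d i) \<alpha> * ?Y = mono_mat p v \<alpha>"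
      unfolding mono_diag_conj[OF \<alpha>] by (rule mono_mat_cong) (use d lt in simp)
    ultimately show "mono_mat p v \<alpha> \<in> G'" by simp
  qed
  show gp: "alternating_mono_group p G'"
  proof
    have "G' = (\<lambda>g. ?X * g * ?Y) ` G" unfolding G'_def by blast
    then show "finite G'" using fin by simp
    show "mat_subgroup p G'"
      unfolding G'_def by (rule mat_subgroup_conj) (use XY subgroup in auto)
    show sub: "G' \<subseteq> Mon p"
    proof
      fix h assume "h \<in> G'"
      then obtain g where g: "h = ?X * g * ?Y" "g \<in> G" unfolding G'_def by blast
      obtain w \<beta> where w: "g = mono_mat p w \<beta>" "\<beta> permutes {..<p}" using g(2) mon by (metis MonE subsetD)
      have m: "M w \<beta>" using w g by (simp add: M_def)
      show "h \<in> Mon p" unfolding g(1) w(1) mono_diag_conj[OF w(2)]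
        by (rule mono_mat_in_Mon[OF w(2)]) (use d permutes_less[OF w(2)] M_nonzero[OF m] in simp)
    qed
    show "perm_part p G' = Alt p"
    proof
      show "perm_part p G' \<subseteq> Alt p"
        using elem M_Alt by (auto simp: perm_part_iff)
      show "Alt p \<subseteq> perm_part p G'"
      proof
        fix \<alpha> assume a: "\<alpha> \<in> Alt p"
        note per = AltD(1)[OF a]
        obtain w where w: "M w \<alpha>" using M.surj_Alt[OF a] by blast
        let ?v = "\<lambda>i. d i * w i / d (\<alpha> i)"
        have "M (\<lambda>i. ?v i * d (\<alpha> i) / d i) \<alpha>"
          by (rule M.cong[OF w]) (use d permutes_less[OF per] in simp)
        then have v: "mono_mat p ?v \<alpha> \<in> G'" using elem[OF per] by simp
        then have "?v i \<noteq> 0" if "i < p" for i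
          using mono_mat_in_MonD[OF subsetD[OF sub v] per that] by simp
        with v show "\<alpha> \<in> perm_part p G'"
          unfolding perm_part_iff using per by (intro conjI exI[of _ ?v]) simp_all
      qed
    qed
  qed (rule p7)
  show "alternating_mono_group.M p G' v \<alpha> \<longleftrightarrow> M (\<lambda>i. v i * d (\<alpha> i) / d i) \<alpha>"
    unfolding alternating_mono_group.M_def[OF gp] using elem by (auto simp: M_def)
qed

text \<open>The coboundary found for the powers is lifted to \<open>G\<close> by taking roots. After
  conjugation the powers of the entries of each element are constant, so \<open>perm_mats_in\<close>
  applies and the group splits.\<close>

lemma conj_to_Alt_ext:
  assumes irr: "irreducible_group p G"
  obtains A where "admissible p A" "GL_conj p G (diag_group.Alt_ext p A)"
proof -
  obtain e where e: "\<And>i. i < p \<Longrightarrow> e i \<noteq> 0"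
    "\<And>x \<alpha>. N x \<alpha> \<Longrightarrow> \<exists>z. \<forall>i<p. x i * e (\<alpha> i) = z * e i"
    using N.diagonal_conj by blast
  \<comment> \<open>The power of the conjugating matrix must have entries \<open>1 / e i\<close>.
    Outside the index range \<open>e\<close> may vanish, so \<open>d\<close> is shown to be nonzero
    only below \<open>p\<close>.\<close>
  have "\<forall>i. \<exists>w. w ^ card D.U = 1 / e i" using complex_root_exists[OF D.card_U] by metis
  then obtain d where d: "\<And>i. d i ^ card D.U = 1 / e i" by metis
  have d0: "d i \<noteq> 0" if "i < p" for i
  proof
    assume "d i = 0"
    then have "1 / e i = 0" using d[of i] zero_power[OF D.card_U, where 'a = complex] by simp
    then show False using e(1)[OF that] by simp
  qed
  define G' where "G' = {mono_mat p d id * g * mono_mat p (\<lambda>i. 1 / d i) id | g. g \<in> G}"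
  interpret G': alternating_mono_group p G'
    unfolding G'_def using d0 by (rule diag_conj(1))
  have M': "G'.M v \<alpha> \<longleftrightarrow> M (\<lambda>i. v i * d (\<alpha> i) / d i) \<alpha>" for v \<alpha>
    unfolding G'_def using d0 by (rule diag_conj(2))
  have GL: "GL_conj p G G'" and irr': "irreducible_group p G'"
    unfolding G'_def using diag_conj(3)[of d, OF d0 irr] diag_conj(4)[of d, OF d0] by simp_all
  have Mid: "G'.M v id \<longleftrightarrow> M v id" for v
  proof -
    have "M (\<lambda>i. v i * d (id i) / d i) id \<longleftrightarrow> M v id"
      by (rule iffI; erule M.cong) (use d0 in simp_all)
    then show ?thesis using M' by blast
  qed
  \<comment> \<open>Diagonal matrices commute, so conjugation preserves the diagonal part and hence
    the exponent \<open>card D.U\<close>.\<close>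
  have DD: "G'.diag_part = diag_part"
  proof (intro equalityI subsetI)
    fix g assume "g \<in> G'.diag_part"
    then show "g \<in> diag_part" using Mid diag_part_iff G'.diag_part_iff by (metis G'.D.in_A_E)
  next
    fix g assume "g \<in> diag_part"
    then show "g \<in> G'.diag_part" using Mid diag_part_iff G'.diag_part_iff by (metis D.in_A_E)
  qed
  have const: "\<exists>z. \<forall>i<p. v i ^ card G'.D.U = z" if v: "G'.M v \<alpha>" for v \<alpha>
  proof -
    let ?w = "\<lambda>i. v i * d (\<alpha> i) / d i"
    have w: "M ?w \<alpha>" using v M' by blast
    then have "N (\<lambda>i. ?w i ^ card D.U) \<alpha>" unfolding N_def by blast
    then obtain z where z: "\<forall>i<p. ?w i ^ card D.U * e (\<alpha> i) = z * e i" using e(2) by blast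
    have "v i ^ card D.U = z" if i: "i < p" for i
    proof -
      have ai: "\<alpha> i < p" using w i permutes_less by (auto simp: M_def)
      have "?w i ^ card D.U * e (\<alpha> i) = v i ^ card D.U * e i"
        using e(1)[OF i] e(1)[OF ai] by (simp add: power_mult_distrib power_divide d)
      then show ?thesis using z i e(1)[OF i] by simp
    qed
    then show ?thesis unfolding DD by blast
  qed
  have perms: "perm_mat p \<kappa> \<in> G'" if "\<kappa> \<in> Alt p" for \<kappa>
    using G'.perm_mats_in[OF const that] .
  show thesis
    using that[OF G'.admissible_diag_part[OF G'.not_scalar[OF perms irr']]] GL G'.eq_Alt_ext[OF perms] by simp
qed

end

section \<open>Conjugate groups in the family\<close>

lemma permutes_eq_transpose:
  assumes "\<alpha> i = j" "i \<noteq> j" "\<And>l. l \<noteq> i \<Longrightarrow> l \<noteq> j \<Longrightarrow> \<alpha> l = l" "bij \<alpha>"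
  shows "\<alpha> = transpose i j"
proof
  have "\<alpha> j = i"
  proof (rule ccontr)
    assume ne: "\<alpha> j \<noteq> i"
    have "\<alpha> j \<noteq> j" using assms(1,2,4) by (metis bij_pointE)
    then have "\<alpha> (\<alpha> j) = \<alpha> j" using ne assms(3) by blast
    then show False using \<open>\<alpha> j \<noteq> j\<close> assms(4) by (metis bij_pointE)
  qed
  then show "\<alpha> x = transpose i j x" for x
    using assms(1,3) by (cases "x = i"; cases "x = j") (auto simp: transpose_def)
qed

text \<open>A nontrivial even \<open>\<alpha>\<close> with \<open>\<alpha> i = j\<close> is no
  transposition, so it moves some third point \<open>l\<close>. The conjugate by
  \<open>tc j k l\<close> sends \<open>i\<close> to \<open>k\<close> and \<open>j\<close> to
  \<open>\<alpha> l\<close>; commuting at \<open>i\<close> would force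
  \<open>\<alpha> l = \<alpha> k\<close>.\<close>

lemma Alt_commutes_conjugates:
  assumes \<alpha>: "\<alpha> \<in> Alt p" and p: "5 \<le> p"
    and comm: "\<And>\<tau>. \<tau> \<in> Alt p \<Longrightarrow> \<tau> \<circ> \<alpha> \<circ> inv_into UNIV \<tau> \<circ> \<alpha> = \<alpha> \<circ> (\<tau> \<circ> \<alpha> \<circ> inv_into UNIV \<tau>)"
  shows "\<alpha> = id"
proof (rule ccontr)
  assume "\<alpha> \<noteq> id"
  note per = AltD(1)[OF \<alpha>]
  have lt: "\<alpha> x < p" if "x < p" for x using permutes_less[OF per that] .
  have inj: "\<alpha> x = \<alpha> y \<longleftrightarrow> x = y" for x y using permutes_inj[OF per] by (rule inj_eq)
  obtain i where i: "\<alpha> i \<noteq> i" using \<open>\<alpha> \<noteq> id\<close> by (auto simp: fun_eq_iff)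
  then have ip: "i < p" using per by (auto simp: permutes_def)
  define j where "j = \<alpha> i"
  have "\<exists>l. l \<noteq> i \<and> l \<noteq> j \<and> \<alpha> l \<noteq> l"
  proof (rule ccontr)
    assume "\<not> ?thesis"
    then have "\<alpha> = transpose i j"
      using i permutes_bij[OF per] by (intro permutes_eq_transpose) (auto simp: j_def)
    moreover have "\<not> evenperm (transpose i j)" using i by (simp add: evenperm_swap j_def)
    ultimately show False using AltD(2)[OF \<alpha>] by metis
  qed
  then obtain l where l: "l \<noteq> i" "l \<noteq> j" "\<alpha> l \<noteq> l" by blast
  then have lp: "l < p" using per by (auto simp: permutes_def)
  \<comment> \<open>Avoiding \<open>\<alpha> l\<close> as well ensures that the cycle fixes
    \<open>\<alpha> l\<close>.\<close>
  obtain k where k: "k < p" "k \<notin> set [i, j, l, \<alpha> l]"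
    by (rule ex_fresh_list[of "[i, j, l, \<alpha> l]" p]) (use p in auto)
  have d: "distinct [j, k, l]" using l k by auto
  have t: "tc j k l \<in> Alt p" by (rule Alt_tc[OF d]) (use lp k lt[OF ip] in \<open>simp add: j_def\<close>)
  from fun_cong[OF comm[OF t], of i]
  have "tc j k l (\<alpha> (tc l k j (\<alpha> i))) = \<alpha> (tc j k l (\<alpha> (tc l k j i)))"
    by (simp add: inv_tc[OF d])
  moreover have "tc l k j i = i" "tc l k j (\<alpha> i) = l" "tc j k l (\<alpha> i) = k"
    using l k i by (auto simp: tc_def j_def)
  moreover have "tc j k l (\<alpha> l) = \<alpha> l"
    using l k inj[of l i] by (auto simp: tc_def j_def)
  ultimately have "\<alpha> l = \<alpha> k" by simp
  then show False using inj[of l k] k by simp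
qed

lemma (in diag_group) conj_in_A:
  assumes "g \<in> Alt_ext" "a \<in> A"
  shows "\<exists>a'\<in>A. g * a = a' * g"
proof -
  obtain w \<alpha> where g: "g = mono_mat p w \<alpha>" "P w" "\<alpha> \<in> Alt p" using assms(1) by (metis Alt_extE)
  obtain v where v: "a = mono_mat p v id" "P v" using in_A_E[OF assms(2)] .
  have "g * a = mono_mat p (v \<circ> \<alpha>) id * g"
    unfolding g(1) v(1) mono_mat_mult[OF AltD(1)[OF g(3)]] mono_mat_mult[OF permutes_id]
    by (simp add: mult.commute)
  then show ?thesis using permutes_invariant[OF v(2) AltD(1)[OF g(3)]] by blast
qed

lemma (in diag_group) A_commute:
  assumes "a \<in> A" "b \<in> A"
  shows "a * b = b * a"
proof -
  obtain v where v: "a = mono_mat p v id" using in_A_E[OF assms(1)] .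
  obtain w where w: "b = mono_mat p w id" using in_A_E[OF assms(2)] .
  show ?thesis unfolding v w mono_mat_mult[OF permutes_id] by (simp add: mult.commute)
qed

text \<open>The image of \<open>A\<close> is an abelian normal subgroup; so each permutation in
  it commutes with its conjugates under the alternating group.\<close>

lemma conj_diag_part:
  assumes A: "diag_group p A" and B: "diag_group p B"
    and X: "X \<in> carrier_mat p p" and Y: "Y \<in> carrier_mat p p"
    and YX: "Y * X = 1\<^sub>m p"
    and eq: "diag_group.Alt_ext p B = {X * g * Y | g. g \<in> diag_group.Alt_ext p A}"
    and a: "a \<in> A"
  shows "X * a * Y \<in> B"
proof -
  interpret A: diag_group p A by (rule A)
  interpret B: diag_group p B by (rule B)
  have carrA: "g \<in> carrier_mat p p" if "g \<in> A.Alt_ext" for g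
    using A.Alt_ext_subgroup that by (auto simp: mat_subgroup_def)
  have a': "a \<in> A.Alt_ext" using a A.A_subset_Alt_ext by blast
  have in_B: "X * g * Y \<in> B.Alt_ext" if "g \<in> A.Alt_ext" for g using that eq by blast
  obtain v \<alpha> where n: "X * a * Y = mono_mat p v \<alpha>" "B.P v" "\<alpha> \<in> Alt p"
    using B.Alt_extE[OF in_B[OF a']] .
  note per = AltD(1)[OF n(3)]
  have "\<alpha> = id"
  proof (rule Alt_commutes_conjugates[OF n(3)])
    show "5 \<le> p" using A.p7 by simp
    fix \<tau> assume t: "\<tau> \<in> Alt p"
    note tper = AltD(1)[OF t] and tper' = permutes_inv[OF AltD(1)[OF t]]
    \<comment> \<open>Matrix products compose permutations in reverse, so the inverse of
      \<open>\<tau>\<close> is needed to obtain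
      \<open>\<gamma> = \<tau> \<circ> \<alpha> \<circ> ?\<beta>\<close>.\<close>
    let ?\<beta> = "inv_into UNIV \<tau>"
    have "perm_mat p ?\<beta> \<in> B.Alt_ext" by (rule B.perm_mat_in_Alt_ext[OF Alt_inv[OF t]])
    then obtain g where g: "perm_mat p ?\<beta> = X * g * Y" "g \<in> A.Alt_ext" using eq by blast
    obtain b where b: "b \<in> A" "g * a = b * g" using A.conj_in_A[OF g(2) a] by blast
    have b': "b \<in> A.Alt_ext" using b A.A_subset_Alt_ext by blast
    obtain w \<gamma> where w: "X * b * Y = mono_mat p w \<gamma>" "B.P w" "\<gamma> \<in> Alt p"
      using B.Alt_extE[OF in_B[OF b']] .
    note mult = conj_mat_mult[OF X Y _ _ YX]
    have mono: "mono_mat p x \<delta> = mono_mat p y \<epsilon> \<Longrightarrow> B.P y \<Longrightarrow> \<delta> permutes {..<p} \<Longrightarrow>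
        \<epsilon> permutes {..<p} \<Longrightarrow> \<delta> = \<epsilon>" for x y \<delta> \<epsilon>
      using mono_mat_eqD(1) B.P_nonzero by blast
    have "(X * b * Y) * (X * a * Y) = (X * a * Y) * (X * b * Y)"
      unfolding mult[OF carrA[OF b'] carrA[OF a']] mult[OF carrA[OF a'] carrA[OF b']]
      using A.A_commute[OF b(1) a] by simp
    then have e1: "mono_mat p (\<lambda>i. w i * v (\<gamma> i)) (\<alpha> \<circ> \<gamma>) = mono_mat p (\<lambda>i. v i * w (\<alpha> i)) (\<gamma> \<circ> \<alpha>)"
      unfolding w(1) n(1) mono_mat_mult[OF AltD(1)[OF w(3)]] mono_mat_mult[OF per] .
    have "perm_mat p ?\<beta> * (X * a * Y) = (X * b * Y) * perm_mat p ?\<beta>"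
      unfolding g(1) mult[OF carrA[OF g(2)] carrA[OF a']] mult[OF carrA[OF b'] carrA[OF g(2)]] b(2) ..
    then have e2: "mono_mat p (\<lambda>i. 1 * v (?\<beta> i)) (\<alpha> \<circ> ?\<beta>) = mono_mat p (\<lambda>i. w i * 1) (?\<beta> \<circ> \<gamma>)"
      unfolding w(1) n(1) perm_mat_eq mono_mat_mult[OF AltD(1)[OF w(3)]] mono_mat_mult[OF tper'] .
    have "\<alpha> \<circ> \<gamma> = \<gamma> \<circ> \<alpha>"
    proof (rule mono[OF e1])
      have "B.P (\<lambda>i. v i * (w \<circ> \<alpha>) i)" by (rule B.P_mult[OF n(2) B.permutes_invariant[OF w(2) per]])
      then show "B.P (\<lambda>i. v i * w (\<alpha> i))" by (simp only: comp_apply)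
    qed (use per AltD(1)[OF w(3)] in \<open>auto intro: permutes_compose\<close>)
    moreover have "\<alpha> \<circ> ?\<beta> = ?\<beta> \<circ> \<gamma>"
    proof (rule mono[OF e2])
      show "B.P (\<lambda>i. w i * 1)" using w(2) by (simp only: mult_1_right)
    qed (use per tper' AltD(1)[OF w(3)] in \<open>auto intro: permutes_compose\<close>)
    then have "\<gamma> = \<tau> \<circ> \<alpha> \<circ> ?\<beta>"
      using permutes_inv_o(1)[OF tper] by (metis comp_assoc id_comp)
    ultimately show "\<tau> \<circ> \<alpha> \<circ> ?\<beta> \<circ> \<alpha> = \<alpha> \<circ> (\<tau> \<circ> \<alpha> \<circ> ?\<beta>)" by simp
  qed
  then show ?thesis using n by simp
qed

text \<open>The intertwiner of \<open>A\<close> and \<open>B\<close> maps the coordinate lines, which carry pairwise distinct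
  characters of \<open>B\<close>, to coordinate lines.\<close>

lemma diag_group_conj_subset:
  assumes A: "diag_group p A" and B: "diag_group p B" and ns: "\<not> B \<subseteq> Scal p"
    and X: "X \<in> carrier_mat p p" and Y: "Y \<in> carrier_mat p p"
    and XY: "X * Y = 1\<^sub>m p"
    and conj: "\<And>b. b \<in> B \<Longrightarrow> Y * b * X \<in> A"
  shows "B \<subseteq> A"
proof -
  interpret A: diag_group p A by (rule A)
  interpret B: diag_group p B by (rule B)
  \<comment> \<open>This compares the entries of \<open>X * a = b * X\<close>: a nonzero entry of
    \<open>X\<close> matches a diagonal entry of \<open>b\<close> with one of
    \<open>a\<close>.\<close>
  have entry: "X $$ (i, j) * a j = b i * X $$ (i, j)"
    if ij: "i < p" "j < p" and b: "mono_mat p b id \<in> B" and a: "Y * mono_mat p b id * X = mono_mat p a id"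
    for i j a b
  proof -
    have "X * (Y * mono_mat p b id * X) = (X * Y) * mono_mat p b id * X"
      using X Y by (simp add: assoc_mult_mat[where n\<^sub>1 = p and n\<^sub>2 = p and n\<^sub>3 = p and n\<^sub>4 = p])
    then have e: "X * mono_mat p a id = mono_mat p b id * X" 
      unfolding a XY left_mult_one_mat[OF mono_mat_carrier] .
    have "(X * mono_mat p a id) $$ (i, j) = (\<Sum>k\<in>{0..<p}. X $$ (i, k) * mono_mat p a id $$ (k, j))"
      using ij X by (simp add: mono_mat_def scalar_prod_def)
    also have "\<dots> = (\<Sum>k\<in>{0..<p}. if k = j then X $$ (i, k) * a k else 0)"
      using ij by (intro sum.cong) (auto simp: mono_mat_index)
    finally have "(X * mono_mat p a id) $$ (i, j) = X $$ (i, j) * a j" using ij by simp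
    moreover have "(mono_mat p b id * X) $$ (i, j) = (\<Sum>k\<in>{0..<p}. mono_mat p b id $$ (i, k) * X $$ (k, j))"
      using ij X by (simp add: mono_mat_def scalar_prod_def)
    moreover have "\<dots> = (\<Sum>k\<in>{0..<p}. if i = k then b i * X $$ (k, j) else 0)"
      using ij by (intro sum.cong) (auto simp: mono_mat_index)
    ultimately show ?thesis using e ij by auto
  qed
  \<comment> \<open>A zero row of \<open>X\<close> would make the corresponding row of
    \<open>X * Y\<close> vanish.\<close>
  have "\<exists>j<p. X $$ (i, j) \<noteq> 0" if "i < p" for i
  proof (rule ccontr)
    assume "\<not> ?thesis"
    then have "(X * Y) $$ (i, i) = 0"
      using X Y that by (auto simp: scalar_prod_def intro!: sum.neutral)
    then show False using XY that by simp
  qed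
  then obtain f where f: "\<And>i. i < p \<Longrightarrow> f i < p \<and> X $$ (i, f i) \<noteq> 0" by metis
  have val: "b i = a (f i)"
    if "i < p" "mono_mat p b id \<in> B" "Y * mono_mat p b id * X = mono_mat p a id" for i a b
    using entry[of i "f i" b a] f[OF that(1)] that by simp
  obtain u where u: "u \<in> B.U" "u \<noteq> 1" using B.U_nontrivial[OF ns] .
  have "inj_on f {..<p}"
  proof (rule inj_onI, rule ccontr)
    fix i i' assume i: "i \<in> {..<p}" "i' \<in> {..<p}" "f i = f i'" "i \<noteq> i'"
    \<comment> \<open>With \<open>k\<close> off both places, \<open>pair_diag i k u\<close> has the
      values \<open>u\<close> at \<open>i\<close> and 1 at \<open>i'\<close>, which
      \<open>f i = f i'\<close> would force to agree.\<close>
    obtain k where k: "k < p" "k \<notin> set [i, i']"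
      by (rule ex_fresh_list[of "[i, i']" p]) (use A.p7 in auto)
    have b: "mono_mat p (pair_diag i k u) id \<in> B" by (rule B.U_D) (use u i k in auto)
    then obtain a where a: "Y * mono_mat p (pair_diag i k u) id * X = mono_mat p a id"
      using conj[OF b] A.in_A_E by metis
    have "pair_diag i k u i = pair_diag i k u i'"
      using val[OF _ b a, of i] val[OF _ b a, of i'] i by simp
    then show False using u(2) i k by (auto simp: pair_diag_def)
  qed
  define \<pi> where "\<pi> i = (if i < p then f i else i)" for i
  have "\<pi> permutes {..<p}"
  proof (rule bij_imp_permutes)
    have "f ` {..<p} \<subseteq> {..<p}" using f by auto
    then have "bij_betw f {..<p} {..<p}"
      using \<open>inj_on f {..<p}\<close> endo_inj_surj[of "{..<p}" f] by (simp add: bij_betw_def)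
    then show "bij_betw \<pi> {..<p} {..<p}"
      by (rule bij_betw_cong[THEN iffD1, rotated]) (simp add: \<pi>_def)
  qed (simp add: \<pi>_def)
  show "B \<subseteq> A"
  proof
    fix b' assume "b' \<in> B"
    then obtain b where b: "b' = mono_mat p b id" "mono_mat p b id \<in> B" using B.in_A_E by metis
    obtain a where a: "Y * mono_mat p b id * X = mono_mat p a id" "mono_mat p a id \<in> A"
      using conj[OF b(2)] A.in_A_E by metis
    have "mono_mat p (a \<circ> \<pi>) id \<in> A" by (rule A.permutes_invariant[OF a(2) \<open>\<pi> permutes {..<p}\<close>])
    moreover have "mono_mat p (a \<circ> \<pi>) id = mono_mat p b id"
      by (rule mono_mat_cong) (use val[OF _ b(2) a(1)] in \<open>simp add: \<pi>_def\<close>)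
    ultimately show "b' \<in> A" using b(1) by simp
  qed
qed

lemma GL_conj_sym:
  assumes "GL_conj p G H" "G \<subseteq> carrier_mat p p"
  shows "GL_conj p H G"
proof -
  obtain X Y where XY: "X \<in> carrier_mat p p" "Y \<in> carrier_mat p p" "X * Y = 1\<^sub>m p" "Y * X = 1\<^sub>m p"
    and H: "H = {X * g * Y | g. g \<in> G}"
    using assms(1) unfolding GL_conj_def by blast
  have c: "Y * (X * g * Y) * X = g" if "g \<in> G" for g
    by (rule conj_mat_cancel) (use XY that assms(2) in auto)
  have "G = {Y * h * X | h. h \<in> H}"
  proof (intro equalityI subsetI)
    fix g assume "g \<in> G"
    then show "g \<in> {Y * h * X | h. h \<in> H}" using c[of g] H by (metis (mono_tags, lifting) mem_Collect_eq)
  next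
    fix g assume "g \<in> {Y * h * X | h. h \<in> H}"
    then obtain h where "g = Y * (X * h * Y) * X" "h \<in> G" using H by blast
    then show "g \<in> G" using c by simp
  qed
  then show ?thesis unfolding GL_conj_def using XY by blast
qed

text \<open>Here \<open>Y\<close> conjugates the extension of \<open>B\<close> to that of
  \<open>A\<close>; \<open>conj_diag_part\<close> restricts this to the diagonal parts, and
  \<open>diag_group_conj_subset\<close> compares them.\<close>

lemma Alt_ext_GL_conj_subset:
  assumes A: "diag_group p A" and B: "diag_group p B" and ns: "\<not> B \<subseteq> Scal p"
    and GL: "GL_conj p (diag_group.Alt_ext p B) (diag_group.Alt_ext p A)"
  shows "B \<subseteq> A"
proof -
  obtain Y X where XY: "Y \<in> carrier_mat p p" "X \<in> carrier_mat p p" "Y * X = 1\<^sub>m p" "X * Y = 1\<^sub>m p"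
    and eq: "diag_group.Alt_ext p A = {Y * g * X | g. g \<in> diag_group.Alt_ext p B}"
    using GL unfolding GL_conj_def by blast
  show ?thesis
    by (rule diag_group_conj_subset[OF A B ns XY(2,1,4)], rule conj_diag_part[OF B A XY(1,2,4) eq])
qed

theorem theorem8p7:
  fixes p :: nat
  assumes "prime p" and "p \<ge> 7"
  defines "\<F> \<equiv> {gen_group p ({s_mat p, w_mat p} \<union> A) | A. admissible p A}"
  shows "(\<forall>G\<in>\<F>. finite G \<and> mat_subgroup p G \<and> G \<subseteq> Mon p \<and> irreducible_group p G \<and>
            perm_part p G = Alt p)
       \<and> (\<forall>G. finite G \<and> mat_subgroup p G \<and> G \<subseteq> Mon p \<and> irreducible_group p G \<and>
            perm_part p G = Alt p \<longrightarrow> (\<exists>H\<in>\<F>. GL_conj p G H))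
       \<and> (\<forall>G\<in>\<F>. \<forall>H\<in>\<F>. GL_conj p G H \<longrightarrow> G = H)"
proof -
  have odd: "odd p" using prime_odd_nat[OF assms(1)] assms(2) by simp
  have dg: "diag_group p A" if "admissible p A" for A
    using admissible_diag_group[OF that assms(2)] .
  have ns: "\<not> A \<subseteq> Scal p" if "admissible p A" for A using that by (simp add: admissible_def)
  have F: "\<F> = {diag_group.Alt_ext p A | A. admissible p A}"
    unfolding \<F>_def using diag_group.gen_group_eq[OF dg odd] by metis
  show ?thesis
  proof (intro conjI ballI allI impI)
    fix G assume "G \<in> \<F>"
    then obtain A where A: "G = diag_group.Alt_ext p A" "admissible p A" unfolding F by blast
    interpret diag_group p A by (rule dg[OF A(2)])
    show "finite G" "mat_subgroup p G" "G \<subseteq> Mon p" "irreducible_group p G" "perm_part p G = Alt p"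
      unfolding A(1) using Alt_ext_finite Alt_ext_subgroup Alt_ext_Mon
        Alt_ext_irreducible[OF ns[OF A(2)]] Alt_ext_perm_part by blast+
  next
    fix G assume G: "finite G \<and> mat_subgroup p G \<and> G \<subseteq> Mon p \<and> irreducible_group p G \<and>
      perm_part p G = Alt p"
    then interpret alternating_mono_group p G by unfold_locales (use assms(2) in auto)
    obtain A where "admissible p A" "GL_conj p G (diag_group.Alt_ext p A)"
      using conj_to_Alt_ext G by blast
    then show "\<exists>H\<in>\<F>. GL_conj p G H" unfolding F by blast
  next
    fix G H assume "G \<in> \<F>" "H \<in> \<F>" and GH: "GL_conj p G H"
    then obtain A B where A: "G = diag_group.Alt_ext p A" "admissible p A"
      and B: "H = diag_group.Alt_ext p B" "admissible p B" unfolding F by blast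
    have "G \<subseteq> carrier_mat p p"
      unfolding A(1) by (rule mat_subgroupD(1)[OF diag_group.Alt_ext_subgroup[OF dg[OF A(2)]]])
    \<comment> \<open>Each direction of conjugation yields one inclusion between the diagonal
      groups.\<close>
    then have HG: "GL_conj p H G" by (rule GL_conj_sym[OF GH])
    have "A \<subseteq> B"
      using Alt_ext_GL_conj_subset[OF dg[OF B(2)] dg[OF A(2)] ns[OF A(2)]] GH A B by simp
    moreover have "B \<subseteq> A"
      using Alt_ext_GL_conj_subset[OF dg[OF A(2)] dg[OF B(2)] ns[OF B(2)]] HG A B by simp
    ultimately show "G = H" using A B by simp
  qed
qed

end
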